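(* Let $m\ge 0$ be an integer, $1\le p<\infty$, $r>0$, and let $g\in\mathcal{BMO}_r^p$ (with $g\in\Omega_m$). Then the Hankel operators $H_g^p$ and $H_{\bar g}^p$ are bounded from $\mathscr{F}^{p,m}$ to $L^{p,m}$.
   Context: $dA$ is Lebesgue area measure on $\mathbb{C}$, and $m$ is a fixed non-negative integer. For $1\le p<\infty$, $L^{p,m}$ is the space of Lebesgue measurable $f$ on $\mathbb{C}$ with $\|f\|_{p,m}=\{\omega_{p,m}\int_{\mathbb{C}}|f(v)|^p|v|^{mp}e^{-\frac p2|v|^2}dA(v)\}^{1/p}<\infty$, where $\omega_{p,m}=(\tfrac p2)^{\frac{mp}{2}+1}\frac{1}{\pi\Gamma(\frac{mp}{2}+1)}$. The Fock-Sobolev space $\mathscr{F}^{p,m}$ is the closed subspace of entire functions in $L^{p,m}$, with the same norm. The reproducing kernel of $\mathscr{F}^{2,m}$ is $K_z^m(v)=\sum_{k=0}^\infty\frac{m!}{(k+m)!}(\bar z v)^k$, and $k_z^m=K_z^m/\sqrt{K_z^m(z)}$. The projection is $P^m f(z)=\frac{1}{\pi m!}\int_{\mathbb{C}}f(v)\overline{K_z^m(v)}|v|^{2m}e^{-|v|^2}dA(v)$; it is a bounded projection of $L^{p,m}$ onto $\mathscr{F}^{p,m}$. $\Omega_m$ is the set of measurable $g$ on $\mathbb{C}$ such that $gk_v^m\in\bigcup_{p'\ge1}L^{p',m}$ for each $v\in\mathbb{C}$. For $g\in\Omega_m$ the Hankel operator $H_g^p:\mathscr{F}^{p,m}\to L^{p,m}$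 is $H_g^pf=(I-P^m)(gf)$, i.e. $H_g^pf(z)=\frac{1}{\pi m!}\int_{\mathbb{C}}(g(z)-g(v))f(v)\overline{K_z^m(v)}|v|^{2m}e^{-|v|^2}dA(v)$, for those $f\in\mathscr{F}^{p,m}$ for which the integral converges absolutely for almost every $z$ (in particular on the linear span of the kernel functions $k_v^m$). "Bounded" means that this defines a bounded linear operator $\mathscr{F}^{p,m}\to L^{p,m}$. $\mathscr{B}(z;r)=\{v\in\mathbb{C}:|v-z|\le r\}$. $L^p_{Loc}$ is the space of measurable functions on $\mathbb{C}$ that are in $L^p(K,dA)$ for every compact $K\subset\mathbb{C}$. Put $\tilde g_r(z)=\frac1{\pi r^2}\int_{\mathscr{B}(z;r)}g\,dA$. $\mathcal{BMO}_r^p$ is the set of $g\in L^p_{Loc}$ with $\sup_{z\in\mathbb{C}}\left\{\frac1{\pi r^2}\int_{\mathscr{B}(z;r)}|g(v)-\tilde g_r(z)|^pdA(v)\right\}^{1/p}<\infty$. *)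

theory Defs
  imports "HOL-Analysis.Analysis"
begin

text \<open>
  The factor \<open>|v|^{mp}\<close> is written \<open>(cmod v ^ m) powr p\<close>, because \<open>0 powr 0 = 0\<close> would give
  \<open>cmod v powr (m * p)\<close> the wrong value at \<open>v = 0\<close> when \<open>m = 0\<close>.
\<close>

definition Lpm_integrand :: "real \<Rightarrow> nat \<Rightarrow> (complex \<Rightarrow> complex) \<Rightarrow> complex \<Rightarrow> real" where
  "Lpm_integrand p m f v =
     cmod (f v) powr p * (cmod v ^ m) powr p * exp (- (p / 2) * (cmod v)\<^sup>2)"

definition Lpm_const :: "real \<Rightarrow> nat \<Rightarrow> real" where
  "Lpm_const p m =
     (p / 2) powr (real m * p / 2 + 1) * (1 / (pi * Gamma (real m * p / 2 + 1)))"

definition Lpm_norm :: "real \<Rightarrow> nat \<Rightarrow> (complex \<Rightarrow> complex) \<Rightarrow> real" where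
  "Lpm_norm p m f =
     (Lpm_const p m * (LINT v|lebesgue. Lpm_integrand p m f v)) powr (1 / p)"

text \<open>Elements are functions rather than classes modulo almost-everywhere equality.\<close>

definition Lpm :: "real \<Rightarrow> nat \<Rightarrow> (complex \<Rightarrow> complex) set" where
  "Lpm p m = {f. f \<in> borel_measurable lebesgue \<and> integrable lebesgue (Lpm_integrand p m f)}"

definition Fock_Sobolev :: "real \<Rightarrow> nat \<Rightarrow> (complex \<Rightarrow> complex) set" where
  "Fock_Sobolev p m = {f \<in> Lpm p m. f holomorphic_on UNIV}"

definition kernel :: "nat \<Rightarrow> complex \<Rightarrow> complex \<Rightarrow> complex" where
  "kernel m z v = (\<Sum>k. fact m / fact (k + m) * (cnj z * v) ^ k)"

text \<open>\<open>kernel m z z\<close> is a positive real, on which \<^const>\<open>csqrt\<close> is the usual square root.\<close>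

definition normalized_kernel :: "nat \<Rightarrow> complex \<Rightarrow> complex \<Rightarrow> complex" where
  "normalized_kernel m z v = kernel m z v / csqrt (kernel m z z)"

definition proj_integrand ::
    "nat \<Rightarrow> (complex \<Rightarrow> complex) \<Rightarrow> complex \<Rightarrow> complex \<Rightarrow> complex" where
  "proj_integrand m f z v =
     f v * cnj (kernel m z v) * of_real (cmod v ^ (2 * m) * exp (- (cmod v)\<^sup>2))"

definition Fock_proj :: "nat \<Rightarrow> (complex \<Rightarrow> complex) \<Rightarrow> complex \<Rightarrow> complex" where
  "Fock_proj m f z = 1 / (of_real pi * fact m) * (LINT v|lebesgue. proj_integrand m f z v)"

definition Omega :: "nat \<Rightarrow> (complex \<Rightarrow> complex) set" where
  "Omega m = {g. g \<in> borel_measurable lebesgue \<and>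
     (\<forall>v. (\<lambda>w. g w * normalized_kernel m v w) \<in> (\<Union>p'\<in>{1..}. Lpm p' m))}"

text \<open>
  The Hankel operator \<open>(I - P)(g f)\<close> in its integral form
  \<open>1 / (\<pi> m!) \<integral> (g z - g v) f v cnj (K z v) |v|^{2m} exp (-|v|^2) dA v\<close>;
  the two agree since \<open>P f = f\<close> for \<open>f\<close> in the Fock-Sobolev space. The formula does not involve
  \<open>p\<close>, which only enters through the spaces between which the operator acts. The domain is kept
  separate, because the Bochner integral of a non-integrable function is \<open>0\<close>.
\<close>

definition Hankel :: "nat \<Rightarrow> (complex \<Rightarrow> complex) \<Rightarrow> (complex \<Rightarrow> complex) \<Rightarrow> complex \<Rightarrow> complex"
  where "Hankel m g f z = Fock_proj m (\<lambda>v. (g z - g v) * f v) z"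

definition Hankel_domain :: "real \<Rightarrow> nat \<Rightarrow> (complex \<Rightarrow> complex) \<Rightarrow> (complex \<Rightarrow> complex) set"
  where "Hankel_domain p m g = {f \<in> Fock_Sobolev p m.
     AE z in lebesgue. integrable lebesgue (proj_integrand m (\<lambda>v. (g z - g v) * f v) z)}"

text \<open>Linearity is understood almost everywhere, that is, as equality in the space \<^const>\<open>Lpm\<close>.\<close>

definition bounded_linear_Fock_Lpm ::
    "real \<Rightarrow> nat \<Rightarrow> ((complex \<Rightarrow> complex) \<Rightarrow> complex \<Rightarrow> complex) \<Rightarrow> bool" where
  "bounded_linear_Fock_Lpm p m T \<longleftrightarrow>
     (\<forall>f\<in>Fock_Sobolev p m. T f \<in> Lpm p m) \<and>
     (\<forall>f\<in>Fock_Sobolev p m. \<forall>h\<in>Fock_Sobolev p m.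
        AE z in lebesgue. T (\<lambda>v. f v + h v) z = T f z + T h z) \<and>
     (\<forall>f\<in>Fock_Sobolev p m. \<forall>c. AE z in lebesgue. T (\<lambda>v. c * f v) z = c * T f z) \<and>
     (\<exists>C. \<forall>f\<in>Fock_Sobolev p m. Lpm_norm p m (T f) \<le> C * Lpm_norm p m f)"

definition Hankel_bounded :: "real \<Rightarrow> nat \<Rightarrow> (complex \<Rightarrow> complex) \<Rightarrow> bool" where
  "Hankel_bounded p m g \<longleftrightarrow>
     Hankel_domain p m g = Fock_Sobolev p m \<and> bounded_linear_Fock_Lpm p m (Hankel m g)"

definition Lp_loc :: "real \<Rightarrow> (complex \<Rightarrow> complex) set" where
  "Lp_loc p = {g. g \<in> borel_measurable lebesgue \<and>
     (\<forall>K. compact K \<longrightarrow> set_integrable lebesgue K (\<lambda>v. cmod (g v) powr p))}"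

definition disc_mean :: "real \<Rightarrow> (complex \<Rightarrow> complex) \<Rightarrow> complex \<Rightarrow> complex" where
  "disc_mean r g z = of_real (1 / (pi * r\<^sup>2)) * (LINT v:cball z r|lebesgue. g v)"

definition mean_oscillation :: "real \<Rightarrow> real \<Rightarrow> (complex \<Rightarrow> complex) \<Rightarrow> complex \<Rightarrow> real" where
  "mean_oscillation p r g z =
     (1 / (pi * r\<^sup>2) * (LINT v:cball z r|lebesgue. cmod (g v - disc_mean r g z) powr p))
       powr (1 / p)"

definition BMO :: "real \<Rightarrow> real \<Rightarrow> (complex \<Rightarrow> complex) set" where
  "BMO p r = {g \<in> Lp_loc p. bdd_above (range (mean_oscillation p r g))}"

end

theory Submission
  imports Defs "HOL-Complex_Analysis.Cauchy_Integral_Formula"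
begin

text \<open>
  With \<open>F v = |f v| |v|^m exp (-|v|^2/2)\<close> the norm of \<open>f\<close> is, up to a constant, the plain
  Lebesgue \<open>L^p\<close> norm of \<open>F\<close>, and all weights disappear from the problem: the kernel, multiplied by
  the same weight in both variables, is at most a constant times \<open>exp (-|z - v|)\<close>
  (\<open>kernel_decay\<close>). So the weighted modulus of \<open>H_g f\<close> at \<open>z\<close> is dominated by
  \<open>\<integral> |g z - g v| F v exp (-|z - v|) dA v\<close>, and by Hoelder's inequality its \<open>p\<close>-th power by
  \<open>\<integral> |g z - g v|^p (F v)^p exp (-|z - v|) dA v\<close>.

  For a merely \<open>L^p\<close> function \<open>F\<close> that last expression could not be controlled, since \<open>g\<close> is only
  locally in \<open>L^p\<close>. But \<open>f\<close> is entire, so \<open>(F v)^p\<close> is at most a constant times the integral of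
  \<open>F^p\<close> over the disc of radius \<open>r\<close> around \<open>v\<close> (\<open>weighted_abs_submean\<close>). Inserting this,
  integrating over \<open>z\<close> and exchanging the order of integration (\<open>oscillation_Tonelli\<close>) leaves
  \<open>\<integral> (F w)^p J w dA w\<close>, where \<open>J w\<close> is the integral of \<open>|g z - g v|^p exp (-|z - v|)\<close> over all
  \<open>z\<close> and over the \<open>v\<close> in the disc of radius \<open>r\<close> around \<open>w\<close>. It remains to bound \<open>J\<close> uniformly
  (\<open>double_oscillation\<close>): the means of \<open>g\<close> over two discs of radius \<open>r\<close> differ by at most a
  linear function of the distance of the centres (\<open>disc_center_diff\<close>), which the exponential
  absorbs.

  The condition on \<open>g\<close> enters only through the existence of numbers \<open>c z\<close> for which the \<open>L^p\<close>
  distance of \<open>g\<close> to \<open>c z\<close> on the disc around \<open>z\<close> is bounded. Passing to \<open>cnj \<circ> g\<close> and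
  \<open>cnj \<circ> c\<close> preserves it, so the two assertions of the theorem are instances of one.
\<close>

section \<open>Hoelder's inequality with respect to a weight\<close>

text \<open>
  Integrating the tangent-line inequality \<open>t \<le> t^p l^(1-p) / p + (1 - 1/p) l\<close> against \<open>k\<close> and
  optimising over the point of tangency \<open>l\<close> gives the inequality for all \<open>p \<ge> 1\<close> at once, without
  a conjugate exponent.
\<close>

lemma holder_weighted:
  fixes k \<phi> :: "'a \<Rightarrow> real"
  assumes p: "1 \<le> p" and k: "integrable M k" "\<And>x. 0 \<le> k x" and K: "integral\<^sup>L M k \<le> K" "0 < K"
    and \<phi>: "\<phi> \<in> borel_measurable M" "\<And>x. 0 \<le> \<phi> x"
    and I: "integrable M (\<lambda>x. \<phi> x powr p * k x)"
  shows "integrable M (\<lambda>x. \<phi> x * k x)"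
    and "(\<integral>x. \<phi> x * k x \<partial>M) powr p \<le> K powr (p - 1) * (\<integral>x. \<phi> x powr p * k x \<partial>M)"
proof -
  have [measurable]: "k \<in> borel_measurable M" "\<phi> \<in> borel_measurable M"
    using k \<phi> by auto
  have young: "t \<le> t powr p * l powr (1 - p) / p + (1 - 1 / p) * l" if "0 \<le> t" "0 < l" for t l :: real
  proof (cases "t = 0")
    case True
    then show ?thesis using p that by (simp add: divide_le_eq_1)
  next
    case False
    have "(t powr p * l powr (1 - p)) powr (1 / p) * l powr (1 - 1 / p)
        \<le> 1 / p * (t powr p * l powr (1 - p)) + (1 - 1 / p) * l"
      using p that False by (intro Youngs_inequality_0) auto
    moreover have "(t powr p * l powr (1 - p)) powr (1 / p) * l powr (1 - 1 / p) = t"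
      using p that by (simp add: powr_mult powr_powr mult.assoc flip: powr_add) (simp add: field_simps)
    ultimately show ?thesis by simp
  qed
  show int: "integrable M (\<lambda>x. \<phi> x * k x)"
  proof (rule Bochner_Integration.integrable_bound)
    show "integrable M (\<lambda>x. \<phi> x powr p * k x + k x)" using I k by auto
    have "\<phi> x \<le> \<phi> x powr p + 1" for x
    proof (cases "\<phi> x \<le> 1")
      case False
      then have "\<phi> x powr 1 \<le> \<phi> x powr p" using p by (intro powr_mono) auto
      then show ?thesis using False by simp
    qed (use powr_ge_zero[of "\<phi> x" p] in linarith)
    then have "\<phi> x * k x \<le> (\<phi> x powr p + 1) * k x" for x
      by (intro mult_right_mono k)
    then show "AE x in M. norm (\<phi> x * k x) \<le> norm (\<phi> x powr p * k x + k x)"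
      using k \<phi> by (auto simp: algebra_simps intro!: AE_I2)
  qed auto
  define S where "S = (\<integral>x. \<phi> x powr p * k x \<partial>M)"
  define T where "T = (\<integral>x. \<phi> x * k x \<partial>M)"
  have S0: "0 \<le> S" and T0: "0 \<le> T"
    unfolding S_def T_def using k \<phi> by (auto intro!: integral_nonneg_AE)
  have T_le: "T \<le> S * l powr (1 - p) / p + (1 - 1 / p) * l * K" if "0 < l" for l
  proof -
    have "T \<le> (\<integral>x. (l powr (1 - p) / p) * (\<phi> x powr p * k x) + ((1 - 1 / p) * l) * k x \<partial>M)"
      unfolding T_def
    proof (rule integral_mono[OF int])
      show "\<phi> x * k x \<le> (l powr (1 - p) / p) * (\<phi> x powr p * k x) + ((1 - 1 / p) * l) * k x" for x
        using mult_right_mono[OF young[OF \<phi>(2)[of x] that] k(2)[of x]] by (simp add: algebra_simps)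
    qed (use I k in auto)
    also have "\<dots> = (l powr (1 - p) / p) * S + ((1 - 1 / p) * l) * integral\<^sup>L M k"
      unfolding S_def using I k by simp
    also have "\<dots> \<le> (l powr (1 - p) / p) * S + ((1 - 1 / p) * l) * K"
      using p that K by (intro add_left_mono mult_left_mono) (auto simp: divide_le_eq_1)
    finally show ?thesis by (simp add: mult_ac)
  qed
  have "T powr p \<le> K powr (p - 1) * S"
  proof (cases "S = 0")
    case True
    \<comment> \<open>The optimal \<open>l\<close> would be \<open>0\<close>, which is not admissible; it is approached from above.\<close>
    have "T \<le> 0"
    proof (rule field_le_epsilon)
      fix e :: real assume "0 < e"
      then have "T \<le> (1 - 1 / p) * (e / K) * K"
        using T_le[of "e / K"] K True by simp
      also have "\<dots> \<le> e" using K p \<open>0 < e\<close> by (simp add: field_simps)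
      finally show "T \<le> 0 + e" by simp
    qed
    then show ?thesis using True T0 by simp
  next
    case False
    \<comment> \<open>This \<open>l\<close> makes the two terms of \<open>T_le\<close> proportional to the same number \<open>K * l\<close>.\<close>
    define l where "l = (S / K) powr (1 / p)"
    have l: "0 < l" "l powr p = S / K"
      using False S0 K p by (auto simp: l_def powr_powr)
    have "S * l powr (1 - p) = K * l"
      using l K by (simp add: powr_diff field_simps)
    then have "T \<le> K * l"
      using T_le[OF l(1)] p by (simp add: field_simps)
    then have "T powr p \<le> (K * l) powr p"
      using T0 p by (intro powr_mono2) auto
    also have "\<dots> = K powr (p - 1) * S"
      using K l by (simp add: powr_mult powr_diff)
    finally show ?thesis .
  qed
  then show "(\<integral>x. \<phi> x * k x \<partial>M) powr p \<le> K powr (p - 1) * (\<integral>x. \<phi> x powr p * k x \<partial>M)"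
    by (simp add: S_def T_def)
qed

section \<open>Mean values of entire functions over discs\<close>

lemma nn_integral_translation:
  fixes f :: "'a::euclidean_space \<Rightarrow> ennreal"
  assumes [measurable]: "f \<in> borel_measurable borel"
  shows "(\<integral>\<^sup>+x. f (a + x) \<partial>lborel) = (\<integral>\<^sup>+x. f x \<partial>lborel)"
proof -
  have "(\<integral>\<^sup>+x. f x \<partial>lborel) = (\<integral>\<^sup>+x. f x \<partial>distr lborel borel ((+) a))"
    by (simp add: lborel_distr_plus)
  also have "\<dots> = (\<integral>\<^sup>+x. f (a + x) \<partial>lborel)"
    by (subst nn_integral_distr) auto
  finally show ?thesis by simp
qed

lemma nn_integral_reflection:
  fixes f :: "'a::euclidean_space \<Rightarrow> ennreal"
  assumes [measurable]: "f \<in> borel_measurable borel"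
  shows "(\<integral>\<^sup>+x. f (a - x) \<partial>lborel) = (\<integral>\<^sup>+x. f x \<partial>lborel)"
proof -
  have "(\<integral>\<^sup>+x. f x \<partial>lborel) = (\<integral>\<^sup>+x. f x \<partial>density (distr lborel borel (\<lambda>x. a + (-1) *\<^sub>R x)) (\<lambda>_. 1))"
    using lborel_affine[of "-1" a] by simp
  also have "\<dots> = (\<integral>\<^sup>+x. f (a - x) \<partial>lborel)"
    by (simp add: density_1 nn_integral_distr)
  finally show ?thesis by simp
qed

text \<open>
  A locally finite translation invariant measure is unique up to a factor. The standard
  argument for this is applied to Lebesgue measure and its rotated copy: the product of
  \<open>\<integral> f (u x) dx\<close> with the area of the unit disc is turned by Tonelli's theorem and translations
  into \<open>\<integral> f\<close> times the area of the rotated disc, which is the same disc.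
\<close>

lemma nn_integral_rotation:
  fixes f :: "complex \<Rightarrow> ennreal"
  assumes [measurable]: "f \<in> borel_measurable borel" and u: "cmod u = 1"
  shows "(\<integral>\<^sup>+x. f (u * x) \<partial>lborel) = (\<integral>\<^sup>+x. f x \<partial>lborel)"
proof -
  let ?B = "indicator (cball 0 1) :: complex \<Rightarrow> ennreal"
  have [measurable]: "cball 0 1 \<in> sets (borel :: complex measure)" by simp
  have B: "?B (u * x) = ?B x" for x
    using u by (auto simp: indicator_def norm_mult)
  have "(\<integral>\<^sup>+x. f (u * x) \<partial>lborel) * (\<integral>\<^sup>+y. ?B y \<partial>lborel)
      = (\<integral>\<^sup>+x. f (u * x) * (\<integral>\<^sup>+y. ?B (u * x + y) \<partial>lborel) \<partial>lborel)"
    by (subst nn_integral_translation) (simp_all add: nn_integral_multc)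
  also have "\<dots> = (\<integral>\<^sup>+x. \<integral>\<^sup>+y. f (u * x) * ?B (u * x + y) \<partial>lborel \<partial>lborel)"
    by (simp add: nn_integral_cmult)
  also have "\<dots> = (\<integral>\<^sup>+y. \<integral>\<^sup>+x. f (u * x) * ?B (u * x + y) \<partial>lborel \<partial>lborel)"
    by (rule lborel_pair.Fubini') measurable
  also have "\<dots> = (\<integral>\<^sup>+y. \<integral>\<^sup>+x. f (u * (- (cnj u * y) + x)) * ?B (u * (- (cnj u * y) + x) + y) \<partial>lborel \<partial>lborel)"
    by (subst nn_integral_translation[where f = "\<lambda>x. f (u * x) * ?B (u * x + y)" for y]) auto
  also have "\<dots> = (\<integral>\<^sup>+y. \<integral>\<^sup>+x. f (u * x - y) * ?B x \<partial>lborel \<partial>lborel)"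
  proof -
    have uu: "u * cnj u = 1" using complex_norm_square[of u] u by simp
    have "u * (- (cnj u * y) + x) = u * x - (u * cnj u) * y" for x y
      by (simp add: algebra_simps)
    then have "u * (- (cnj u * y) + x) = u * x - y" for x y
      by (simp only: uu mult_1)
    then show ?thesis by (simp add: B)
  qed
  also have "\<dots> = (\<integral>\<^sup>+x. \<integral>\<^sup>+y. f (u * x - y) * ?B x \<partial>lborel \<partial>lborel)"
    by (rule lborel_pair.Fubini') measurable
  also have "\<dots> = (\<integral>\<^sup>+x. (\<integral>\<^sup>+y. f (u * x - y) \<partial>lborel) * ?B x \<partial>lborel)"
    by (simp add: nn_integral_multc)
  also have "\<dots> = (\<integral>\<^sup>+x. f x \<partial>lborel) * (\<integral>\<^sup>+y. ?B y \<partial>lborel)"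
    by (simp add: nn_integral_reflection nn_integral_cmult)
  finally have "(\<integral>\<^sup>+x. f (u * x) \<partial>lborel) * ennreal pi = (\<integral>\<^sup>+x. f x \<partial>lborel) * ennreal pi"
    by (simp add: emeasure_cball unit_ball_vol_2)
  then have "(\<integral>\<^sup>+x. f (u * x) \<partial>lborel) * ennreal pi * ennreal (1 / pi)
      = (\<integral>\<^sup>+x. f x \<partial>lborel) * ennreal pi * ennreal (1 / pi)"
    by simp
  then show ?thesis
    by (simp add: mult.assoc flip: ennreal_mult)
qed

text \<open>
  Cauchy's formula on the unit circle for the function \<open>\<zeta> \<mapsto> G (v + \<zeta> w)\<close>, which treats all radii
  \<open>|w|\<close> at once, including \<open>0\<close>.
\<close>

lemma circle_mean_value:
  fixes G :: "complex \<Rightarrow> complex"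
  assumes "G holomorphic_on UNIV"
  shows "ennreal (cmod (G v)) \<le> (\<integral>\<^sup>+t\<in>{0..1}. ennreal (cmod (G (v + cis (2 * pi * t) * w))) \<partial>lborel)"
proof -
  define H where "H = (\<lambda>\<zeta>. G (v + \<zeta> * w))"
  have H: "H holomorphic_on UNIV"
    unfolding H_def by (intro holomorphic_on_compose_gen[OF _ assms, unfolded o_def] holomorphic_intros) auto
  have contG: "continuous_on UNIV G" using assms by (rule holomorphic_on_imp_continuous_on)
  have "((\<lambda>u. H u / (u - 0)) has_contour_integral 2 * of_real pi * \<i> * H 0) (circlepath 0 1)"
    by (rule Cauchy_integral_circlepath_simple) (auto intro: holomorphic_on_subset[OF H])
  then have "((\<lambda>x. H (circlepath 0 1 x) / circlepath 0 1 x * vector_derivative (circlepath 0 1) (at x))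
      has_integral 2 * of_real pi * \<i> * H 0) {0..1}"
    by (simp add: has_contour_integral)
  moreover have "H (circlepath 0 1 x) / circlepath 0 1 x * vector_derivative (circlepath 0 1) (at x)
      = 2 * of_real pi * \<i> * H (cis (2 * pi * x))" for x
    unfolding vector_derivative_circlepath unfolding circlepath by (simp add: cis_conv_exp mult_ac)
  ultimately have "((\<lambda>x. 2 * of_real pi * \<i> * H (cis (2 * pi * x))) has_integral 2 * of_real pi * \<i> * H 0) {0..1}"
    by simp
  from has_integral_mult_right[OF this, of "1 / (2 * of_real pi * \<i>)"]
  have HI: "((\<lambda>x. H (cis (2 * pi * x))) has_integral H 0) {0..1}" by (simp add: mult_ac)
  have cont: "continuous_on UNIV (\<lambda>x. cmod (H (cis (2 * pi * x))))"
    unfolding H_def by (intro continuous_intros continuous_on_compose2[OF contG]) auto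
  have NI: "((\<lambda>x. cmod (H (cis (2 * pi * x)))) has_integral integral {0..1} (\<lambda>x. cmod (H (cis (2 * pi * x))))) {0..1}"
    by (intro integrable_integral integrable_continuous_real continuous_on_subset[OF cont]) auto
  have "cmod (H 0) \<le> integral {0..1} (\<lambda>x. cmod (H (cis (2 * pi * x))))"
    using integral_norm_bound_integral[OF has_integral_integrable[OF HI] has_integral_integrable[OF NI]]
      integral_unique[OF HI] by simp
  then have "ennreal (cmod (H 0)) \<le> ennreal (integral {0..1} (\<lambda>x. cmod (H (cis (2 * pi * x)))))"
    by (rule ennreal_leI)
  also have "\<dots> = (\<integral>\<^sup>+t\<in>{0..1}. ennreal (cmod (H (cis (2 * pi * t)))) \<partial>lborel)"
    by (rule nn_integral_has_integral_lebesgue'[OF _ NI, symmetric]) simp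
  finally show ?thesis by (simp add: H_def)
qed

text \<open>
  Averaging \<open>circle_mean_value\<close> over all \<open>w\<close> in the disc needs no polar coordinates: after an
  exchange of the integrals, each rotation of the disc contributes the same amount.
\<close>

lemma disc_mean_value:
  fixes G :: "complex \<Rightarrow> complex"
  assumes G: "G holomorphic_on UNIV" and r: "0 < r"
  shows "ennreal (pi * r\<^sup>2) * ennreal (cmod (G v)) \<le> (\<integral>\<^sup>+w\<in>cball v r. ennreal (cmod (G w)) \<partial>lborel)"
proof -
  let ?B = "indicator (cball 0 r) :: complex \<Rightarrow> ennreal"
  have [measurable]: "cball a r \<in> sets (borel :: complex measure)" for a by simp
  have [measurable]: "G \<in> borel_measurable borel"
    using holomorphic_on_imp_continuous_on[OF G] by (rule borel_measurable_continuous_onI)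
  have [measurable]: "cis \<in> borel_measurable borel"
    by (intro borel_measurable_continuous_onI continuous_intros)
  have "ennreal (pi * r\<^sup>2) * ennreal (cmod (G v)) = (\<integral>\<^sup>+w. ennreal (cmod (G v)) * ?B w \<partial>lborel)"
    using r by (subst nn_integral_cmult_indicator) (simp_all add: emeasure_cball unit_ball_vol_2 mult_ac power2_eq_square ennreal_mult)
  also have "\<dots> \<le> (\<integral>\<^sup>+w. (\<integral>\<^sup>+t. ennreal (cmod (G (v + cis (2 * pi * t) * w))) * indicator {0..1} t \<partial>lborel) * ?B w \<partial>lborel)"
    by (intro nn_integral_mono mult_right_mono circle_mean_value G) auto
  also have "\<dots> = (\<integral>\<^sup>+w. \<integral>\<^sup>+t. ennreal (cmod (G (v + cis (2 * pi * t) * w))) * indicator {0..1} t * ?B w \<partial>lborel \<partial>lborel)"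
    by (simp add: nn_integral_multc)
  also have "\<dots> = (\<integral>\<^sup>+t. \<integral>\<^sup>+w. ennreal (cmod (G (v + cis (2 * pi * t) * w))) * indicator {0..1} t * ?B w \<partial>lborel \<partial>lborel)"
    by (rule lborel_pair.Fubini') measurable
  also have "\<dots> = (\<integral>\<^sup>+t. \<integral>\<^sup>+w. indicator {0..1} t * (ennreal (cmod (G (v + cis (2 * pi * t) * w))) * ?B (cis (2 * pi * t) * w)) \<partial>lborel \<partial>lborel)"
    by (intro nn_integral_cong) (auto simp: indicator_def norm_mult)
  also have "\<dots> = (\<integral>\<^sup>+t. indicator {0..1} t * (\<integral>\<^sup>+w. ennreal (cmod (G (v + cis (2 * pi * t) * w))) * ?B (cis (2 * pi * t) * w) \<partial>lborel) \<partial>lborel)"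
    by (simp add: nn_integral_cmult)
  also have "\<dots> = (\<integral>\<^sup>+t. indicator {0..1} t * (\<integral>\<^sup>+w. ennreal (cmod (G (v + w))) * ?B w \<partial>lborel) \<partial>(lborel::real measure))"
    by (subst nn_integral_rotation[where f = "\<lambda>w. ennreal (cmod (G (v + w))) * ?B w"]) auto
  also have "\<dots> = (\<integral>\<^sup>+w. ennreal (cmod (G (v + w))) * ?B w \<partial>lborel)"
    by (simp add: nn_integral_multc)
  also have "\<dots> = (\<integral>\<^sup>+w. ennreal (cmod (G (v + w))) * indicator (cball v r) (v + w) \<partial>lborel)"
    by (intro nn_integral_cong) (auto simp: indicator_def dist_norm)
  also have "\<dots> = (\<integral>\<^sup>+w\<in>cball v r. ennreal (cmod (G w)) \<partial>lborel)"
    by (rule nn_integral_translation[where f = "\<lambda>w. ennreal (cmod (G w)) * indicator (cball v r) w"]) measurable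
  finally show ?thesis .
qed

section \<open>Elementary estimates\<close>

lemma powr_add_le:
  fixes a b p :: real
  assumes "0 \<le> a" "0 \<le> b" "0 \<le> p"
  shows "(a + b) powr p \<le> 2 powr p * (a powr p + b powr p)"
proof -
  have "(a + b) powr p \<le> (2 * max a b) powr p"
    using assms by (intro powr_mono2) auto
  also have "\<dots> = 2 powr p * max a b powr p"
    using assms by (simp add: powr_mult)
  also have "max a b powr p \<le> a powr p + b powr p"
    by (simp add: max_def)
  finally show ?thesis by (simp add: mult_left_mono)
qed

lemma norm_diff_powr_le:
  fixes x y z :: "'a::real_normed_vector"
  assumes "0 \<le> p"
  shows "norm (x - y) powr p \<le> 2 powr p * (norm (x - z) powr p + norm (y - z) powr p)"
proof -
  have "norm (x - y) \<le> norm (x - z) + norm (y - z)"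
    by (metis norm_minus_commute norm_triangle_sub norm_diff_triangle_ineq diff_add_cancel dist_norm dist_triangle2)
  then have "norm (x - y) powr p \<le> (norm (x - z) + norm (y - z)) powr p"
    using assms by (intro powr_mono2) auto
  also have "\<dots> \<le> 2 powr p * (norm (x - z) powr p + norm (y - z) powr p)"
    using assms by (intro powr_add_le) auto
  finally show ?thesis .
qed

lemma powr_le_exp:
  fixes p a t :: real
  assumes "0 < p" "0 < a" "0 \<le> t"
  shows "(1 + t) powr p \<le> exp a * (p / a) powr p * exp (a * t)"
proof -
  have "a * (1 + t) / p \<le> exp (a * (1 + t) / p)"
    using exp_ge_add_one_self[of "a * (1 + t) / p"] by linarith
  then have "1 + t \<le> p / a * exp (a * (1 + t) / p)"
    using assms by (simp add: field_simps)
  then have "(1 + t) powr p \<le> (p / a * exp (a * (1 + t) / p)) powr p"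
    using assms by (intro powr_mono2) auto
  also have "\<dots> = (p / a) powr p * exp (a * (1 + t))"
    using assms by (subst powr_mult) (simp_all add: exp_powr_real)
  finally show ?thesis by (simp add: distrib_left exp_add mult_ac)
qed

text \<open>
  The plane is exhausted by the discs of radius \<open>n + 1\<close>, whose areas grow quadratically, while the
  integrand is at most \<open>exp (- a n)\<close> outside the disc of radius \<open>n\<close>. The value is obtained as a
  real number, the same for all centres.
\<close>

lemma nn_integral_exp_dist_finite:
  assumes "0 < a"
  obtains I where "0 \<le> I" "\<And>w::complex. (\<integral>\<^sup>+z. ennreal (exp (- a * cmod (z - w))) \<partial>lebesgue) = ennreal I"
proof -
  let ?f = "\<lambda>z. ennreal (exp (- a * cmod z))"
  have [measurable]: "?f \<in> borel_measurable borel" by measurable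
  have [measurable]: "cball 0 s \<in> sets (borel :: complex measure)" for s by simp
  have le_suminf: "f n \<le> suminf f" for f :: "nat \<Rightarrow> ennreal" and n
    using sum_le_suminf[of f "{n}"] by simp
  have term_le: "?f z \<le> (\<Sum>n. ennreal (exp (- a * real n)) * indicator (cball 0 (real (Suc n))) z)" for z
  proof -
    define n where "n = nat \<lfloor>cmod z\<rfloor>"
    \<comment> \<open>Only the term with this index is needed.\<close>
    have n: "real n \<le> cmod z" "cmod z \<le> real (Suc n)"
    proof -
      have "real n = real_of_int \<lfloor>cmod z\<rfloor>" by (simp add: n_def)
      then show "real n \<le> cmod z" "cmod z \<le> real (Suc n)" by linarith+
    qed
    then have "?f z \<le> ennreal (exp (- a * real n)) * indicator (cball 0 (real (Suc n))) z"
      using assms by (auto intro!: ennreal_leI)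
    also have "\<dots> \<le> (\<Sum>n. ennreal (exp (- a * real n)) * indicator (cball 0 (real (Suc n))) z)"
      by (rule le_suminf)
    finally show ?thesis .
  qed
  have "(\<integral>\<^sup>+z. ?f z \<partial>lborel) \<le> (\<integral>\<^sup>+z. (\<Sum>n. ennreal (exp (- a * real n)) * indicator (cball (0::complex) (real (Suc n))) z) \<partial>lborel)"
    by (intro nn_integral_mono term_le)
  also have "\<dots> = (\<Sum>n. \<integral>\<^sup>+z. ennreal (exp (- a * real n)) * indicator (cball (0::complex) (real (Suc n))) z \<partial>lborel)"
    by (rule nn_integral_suminf) measurable
  also have "\<dots> = (\<Sum>n. ennreal (exp (- a * real n) * (pi * (real (Suc n))\<^sup>2)))"
    by (subst nn_integral_cmult_indicator)
       (simp_all add: emeasure_cball unit_ball_vol_2 ennreal_mult power2_eq_square)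
  also have "\<dots> < top"
  proof -
    have "summable (\<lambda>n. exp (- a * real n) * (pi * (real (Suc n))\<^sup>2))"
    proof (rule summable_comparison_test')
      let ?C = "pi * (exp (a / 2) * (2 / (a / 2)) powr 2)"
      have "exp (- a / 2) < 1" using assms by simp
      then show "summable (\<lambda>n. ?C * exp (- a / 2) ^ n)"
        by (intro summable_mult summable_geometric) auto
      show "norm (exp (- a * real n) * (pi * (real (Suc n))\<^sup>2)) \<le> ?C * exp (- a / 2) ^ n" for n
      proof -
        have "(real (Suc n))\<^sup>2 = (1 + real n) powr 2" by (simp add: powr_numeral)
        also have "\<dots> \<le> exp (a / 2) * (2 / (a / 2)) powr 2 * exp (a / 2 * real n)"
          using assms by (intro powr_le_exp) auto
        finally have "exp (- a * real n) * (pi * (real (Suc n))\<^sup>2)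
            \<le> exp (- a * real n) * (pi * (exp (a / 2) * (2 / (a / 2)) powr 2 * exp (a / 2 * real n)))"
          by (intro mult_left_mono) auto
        also have "\<dots> = ?C * (exp (- a * real n) * exp (a / 2 * real n))" by (simp add: mult_ac)
        also have "exp (- a * real n) * exp (a / 2 * real n) = exp (- a / 2) ^ n"
          by (simp add: exp_of_nat_mult[symmetric] mult_ac flip: exp_add)
        finally show ?thesis by simp
      qed
    qed
    then show ?thesis by (subst suminf_ennreal2) auto
  qed
  finally have fin: "(\<integral>\<^sup>+z. ?f z \<partial>lborel) < top" .
  have "(\<integral>\<^sup>+z. ennreal (exp (- a * cmod (z - w))) \<partial>lebesgue) = (\<integral>\<^sup>+z. ?f z \<partial>lborel)" for w
    using nn_integral_translation[of ?f "- w"] by (simp add: nn_integral_completion)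
  then show ?thesis
    using fin that[of "enn2real (\<integral>\<^sup>+z. ?f z \<partial>lborel)"] by (simp add: less_top)
qed

section \<open>Tonelli's theorem for the completed Lebesgue measure\<close>

lemma sigma_finite_lebesgue: "sigma_finite_measure (lebesgue :: 'a::euclidean_space measure)"
proof -
  obtain A :: "'a set set" where A: "countable A" "A \<subseteq> sets lborel" "\<Union>A = space lborel" "\<forall>a\<in>A. emeasure lborel a \<noteq> \<infinity>"
    using lborel.sigma_finite_countable by auto
  show ?thesis
    by standard (use A in \<open>auto intro!: exI[of _ A]\<close>)
qed

lemma pair_sigma_finite_lebesgue:
  "pair_sigma_finite (lebesgue :: 'a::euclidean_space measure) (lebesgue :: 'a measure)"
  by (simp add: pair_sigma_finite_def sigma_finite_lebesgue)

text \<open>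
  The \<open>\<sigma>\<close>-algebra of \<^term>\<open>lebesgue\<close> is finer than the Borel sets, so the projections have to be
  known as measurable maps to \<^term>\<open>borel\<close> as well as to \<^term>\<open>lebesgue\<close>.
\<close>

lemma borel_measurable_fst_lebesgue [measurable]:
  "fst \<in> borel_measurable ((lebesgue :: 'a::euclidean_space measure) \<Otimes>\<^sub>M (lebesgue :: 'a measure))"
  by (rule measurable_compose[OF measurable_fst, of "\<lambda>x. x" , simplified]) (auto intro: measurable_completion)

lemma borel_measurable_snd_lebesgue [measurable]:
  "snd \<in> borel_measurable ((lebesgue :: 'a::euclidean_space measure) \<Otimes>\<^sub>M (lebesgue :: 'a measure))"
  by (rule measurable_compose[OF measurable_snd, of "\<lambda>x. x", simplified]) (auto intro: measurable_completion)

lemma borel_measurable_id_lebesgue: "(\<lambda>x. x) \<in> borel_measurable (lebesgue :: 'a::euclidean_space measure)"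
  by (auto intro: measurable_completion)

lemma lebesgue_Tonelli:
  fixes f :: "'a::euclidean_space \<Rightarrow> 'a \<Rightarrow> ennreal"
  assumes "case_prod f \<in> borel_measurable (lebesgue \<Otimes>\<^sub>M lebesgue)"
  shows "(\<integral>\<^sup>+x. \<integral>\<^sup>+y. f x y \<partial>lebesgue \<partial>lebesgue) = (\<integral>\<^sup>+y. \<integral>\<^sup>+x. f x y \<partial>lebesgue \<partial>lebesgue)"
  using pair_sigma_finite.Fubini'[OF pair_sigma_finite_lebesgue assms] by simp


section \<open>Functions of bounded mean oscillation\<close>

text \<open>
  Bochner integrals of functions that are not integrable are \<open>0\<close>, so the bound on the mean
  oscillation has content only because \<open>g\<close> is locally in \<open>L^p\<close>.
\<close>

lemma BMO_disc_oscillation: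
  assumes p: "1 \<le> p" and r: "0 < r" and g: "g \<in> BMO p r"
  obtains N where "0 \<le> N"
    "\<And>z. (\<integral>\<^sup>+v\<in>cball z r. ennreal (cmod (g v - disc_mean r g z) powr p) \<partial>lebesgue) \<le> ennreal N"
proof -
  have [measurable]: "g \<in> borel_measurable lebesgue" using g by (simp add: BMO_def Lp_loc_def)
  have [measurable]: "cball z s \<in> sets (lebesgue :: complex measure)" for z s by simp
  obtain M where M: "\<And>z. mean_oscillation p r g z \<le> M"
    using g by (auto simp: BMO_def bdd_above_def)
  define N where "N = pi * r\<^sup>2 * (max M 0) powr p"
  have "(\<integral>\<^sup>+v\<in>cball z r. ennreal (cmod (g v - disc_mean r g z) powr p) \<partial>lebesgue) \<le> ennreal N" for z
  proof -
    let ?c = "disc_mean r g z"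
    let ?h = "\<lambda>v. indicator (cball z r) v * (cmod (g v - ?c) powr p)"
    have "integrable lebesgue (\<lambda>v. 2 powr p * (indicator (cball z r) v * (cmod (g v) powr p) + indicator (cball z r) v * (cmod ?c powr p)))"
    proof (intro integrable_mult_right Bochner_Integration.integrable_add)
      have "set_integrable lebesgue (cball z r) (\<lambda>v. cmod (g v) powr p)"
        using g by (simp add: BMO_def Lp_loc_def)
      then show "integrable lebesgue (\<lambda>v. indicator (cball z r) v * (cmod (g v) powr p))"
        by (simp add: set_integrable_def)
      show "integrable lebesgue (\<lambda>v. indicator (cball z r) v * (cmod ?c powr p))"
        using r by (intro integrable_mult_left integrable_real_indicator) (simp_all add: emeasure_cball)
    qed
    then have int: "integrable lebesgue ?h"
    proof (rule Bochner_Integration.integrable_bound)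
      show "AE v in lebesgue. norm (?h v) \<le> norm (2 powr p * (indicator (cball z r) v * (cmod (g v) powr p) + indicator (cball z r) v * (cmod ?c powr p)))"
        using norm_diff_powr_le[of p _ ?c 0] p by (auto simp: indicator_def)
    qed measurable
    define J where "J = (\<integral>v. ?h v \<partial>lebesgue)"
    have J0: "0 \<le> J" unfolding J_def by (rule integral_nonneg_AE) simp
    have "(1 / (pi * r\<^sup>2) * J) powr (1 / p) \<le> max M 0"
      using M[of z] by (simp add: mean_oscillation_def set_lebesgue_integral_def J_def)
    then have "((1 / (pi * r\<^sup>2) * J) powr (1 / p)) powr p \<le> max M 0 powr p"
      using p by (intro powr_mono2) auto
    then have "1 / (pi * r\<^sup>2) * J \<le> max M 0 powr p"
      using p J0 r by (simp add: powr_powr)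
    then have JN: "J \<le> N" using r by (simp add: N_def field_simps)
    have "(\<integral>\<^sup>+v\<in>cball z r. ennreal (cmod (g v - ?c) powr p) \<partial>lebesgue) = (\<integral>\<^sup>+v. ennreal (?h v) \<partial>lebesgue)"
      by (intro nn_integral_cong) (auto simp: indicator_def)
    also have "\<dots> = ennreal J" unfolding J_def by (rule nn_integral_eq_integral[OF int]) simp
    also have "\<dots> \<le> ennreal N" using JN by (rule ennreal_leI)
    finally show ?thesis .
  qed
  moreover have "0 \<le> N" by (simp add: N_def)
  ultimately show ?thesis using that by blast
qed

text \<open>
  If \<open>|z - w| \<le> r\<close>, the discs around \<open>z\<close> and \<open>w\<close> share the disc of radius \<open>r/2\<close> around the
  midpoint, on which \<open>g\<close> is close in \<open>L^p\<close> to both \<open>c z\<close> and \<open>c w\<close>. Points further apart are joined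
  by a chain of steps of length at most \<open>r\<close>.
\<close>

lemma disc_center_diff:
  fixes g :: "complex \<Rightarrow> complex"
  assumes [measurable]: "g \<in> borel_measurable lebesgue" and p: "1 \<le> p" and r: "0 < r" and N: "0 \<le> N"
    and osc: "\<And>z. (\<integral>\<^sup>+v\<in>cball z r. ennreal (cmod (g v - c z) powr p) \<partial>lebesgue) \<le> ennreal N"
  obtains B where "0 \<le> B" "\<And>z w. cmod (c z - c w) \<le> B * (1 + cmod (z - w) / r)"
proof -
  have [measurable]: "cball z s \<in> sets (lebesgue :: complex measure)" for z s by simp
  define B where "B = (2 powr p * (N + N) / (pi * (r / 2)\<^sup>2)) powr (1 / p)"
  have near: "cmod (c z - c w) \<le> B" if zw: "cmod (z - w) \<le> r" for z w
  proof -
    let ?D = "cball ((z + w) / 2) (r / 2)"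
    have "?D \<subseteq> cball z r" "?D \<subseteq> cball w r"
    proof -
      have "dist z ((z + w) / 2) = cmod (z - w) / 2" "dist w ((z + w) / 2) = cmod (z - w) / 2"
      proof -
        have "z - (z + w) / 2 = (z - w) / 2" "w - (z + w) / 2 = - ((z - w) / 2)"
          by (simp_all add: field_simps)
        then show "dist z ((z + w) / 2) = cmod (z - w) / 2" "dist w ((z + w) / 2) = cmod (z - w) / 2"
          by (simp_all only: dist_norm norm_minus_cancel norm_divide norm_numeral)
      qed
      with zw show "?D \<subseteq> cball z r" "?D \<subseteq> cball w r"
        by (auto simp: subset_iff dist_commute intro: order_trans[OF dist_triangle[of _ _ "(z + w) / 2"]])
    qed
    then have sub: "indicator ?D v \<le> (indicator (cball z r) v :: ennreal)"
      "indicator ?D v \<le> (indicator (cball w r) v :: ennreal)" for v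
      by (auto simp: indicator_def)
    have "ennreal (cmod (c z - c w) powr p) * ennreal (pi * (r / 2)\<^sup>2)
        = (\<integral>\<^sup>+v\<in>?D. ennreal (cmod (c z - c w) powr p) \<partial>lebesgue)"
      using r by (subst nn_integral_cmult_indicator) (simp_all add: emeasure_cball unit_ball_vol_2 ennreal_mult power2_eq_square)
    also have "\<dots> \<le> (\<integral>\<^sup>+v. ennreal (2 powr p) * (ennreal (cmod (g v - c z) powr p) * indicator (cball z r) v
        + ennreal (cmod (g v - c w) powr p) * indicator (cball w r) v) \<partial>lebesgue)"
    proof (rule nn_integral_mono)
      fix v :: complex
      have "cmod (c z - c w) powr p \<le> 2 powr p * (cmod (g v - c z) powr p + cmod (g v - c w) powr p)"
        using norm_diff_powr_le[of p "c z" "c w" "g v"] p by (simp add: norm_minus_commute)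
      then have "ennreal (cmod (c z - c w) powr p) \<le> ennreal (2 powr p) * (ennreal (cmod (g v - c z) powr p) + ennreal (cmod (g v - c w) powr p))"
        by (simp add: ennreal_leI flip: ennreal_mult ennreal_plus)
      then have "ennreal (cmod (c z - c w) powr p) * indicator ?D v
          \<le> ennreal (2 powr p) * (ennreal (cmod (g v - c z) powr p) + ennreal (cmod (g v - c w) powr p)) * indicator ?D v"
        by (rule mult_right_mono) simp
      also have "\<dots> = ennreal (2 powr p) * (ennreal (cmod (g v - c z) powr p) * indicator ?D v
        + ennreal (cmod (g v - c w) powr p) * indicator ?D v)"
        by (simp add: algebra_simps)
      also have "\<dots> \<le> ennreal (2 powr p) * (ennreal (cmod (g v - c z) powr p) * indicator (cball z r) v
        + ennreal (cmod (g v - c w) powr p) * indicator (cball w r) v)"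
        by (intro mult_left_mono add_mono sub) auto
      finally show "ennreal (cmod (c z - c w) powr p) * indicator ?D v \<le> ennreal (2 powr p) * (ennreal (cmod (g v - c z) powr p) * indicator (cball z r) v
        + ennreal (cmod (g v - c w) powr p) * indicator (cball w r) v)" .
    qed
    also have "\<dots> = ennreal (2 powr p) * ((\<integral>\<^sup>+v\<in>cball z r. ennreal (cmod (g v - c z) powr p) \<partial>lebesgue)
        + (\<integral>\<^sup>+v\<in>cball w r. ennreal (cmod (g v - c w) powr p) \<partial>lebesgue))"
      by (subst nn_integral_cmult, measurable, subst nn_integral_add) measurable
    also have "\<dots> \<le> ennreal (2 powr p) * (ennreal N + ennreal N)"
      by (intro mult_left_mono add_mono osc) auto
    finally have "ennreal (cmod (c z - c w) powr p * (pi * (r / 2)\<^sup>2)) \<le> ennreal (2 powr p * (N + N))"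
      using N by (simp flip: ennreal_mult ennreal_plus)
    then have "cmod (c z - c w) powr p * (pi * (r / 2)\<^sup>2) \<le> 2 powr p * (N + N)"
      using N by (subst (asm) ennreal_le_iff) auto
    then have "cmod (c z - c w) powr p \<le> 2 powr p * (N + N) / (pi * (r / 2)\<^sup>2)"
      using r by (simp add: pos_le_divide_eq)
    then have "(cmod (c z - c w) powr p) powr (1 / p) \<le> B"
      unfolding B_def using p by (intro powr_mono2) auto
    then show ?thesis using p by (simp add: powr_powr)
  qed
  have chain: "cmod (z - w) \<le> real n * r \<Longrightarrow> cmod (c z - c w) \<le> real n * B" for n z w
  proof (induction n arbitrary: z)
    case 0
    then show ?case by simp
  next
    case (Suc n)
    \<comment> \<open>The point at distance \<open>|z - w| / (n + 1)\<close> from \<open>z\<close> on the segment from \<open>z\<close> to \<open>w\<close>.\<close>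
    define y where "y = w + (real n / real (Suc n)) *\<^sub>R (z - w)"
    have "y - w = (real n / real (Suc n)) *\<^sub>R (z - w)" by (simp add: y_def)
    then have yw: "cmod (y - w) = real n / real (Suc n) * cmod (z - w)" by simp
    have "1 - real n / real (Suc n) = 1 / real (Suc n)" by (simp add: field_simps)
    moreover have "z - y = (1 - real n / real (Suc n)) *\<^sub>R (z - w)"
      unfolding y_def by (simp only: scaleR_diff_left scaleR_one) (simp only: diff_diff_eq)
    ultimately have "z - y = (1 / real (Suc n)) *\<^sub>R (z - w)" by (simp only:)
    then have zy: "cmod (z - y) = (1 / real (Suc n)) * cmod (z - w)" by (simp only: norm_scaleR) simp
    have "cmod (z - w) / real (Suc n) \<le> r" using Suc.prems by (simp add: field_simps)
    with yw zy have "cmod (y - w) \<le> real n * r" "cmod (z - y) \<le> r"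
      by (simp_all add: mult_left_mono times_divide_eq_right[symmetric] del: times_divide_eq_right)
    then have "cmod (c y - c w) \<le> real n * B" "cmod (c z - c y) \<le> B"
      using Suc.IH near by blast+
    then show ?case
      using norm_triangle_ineq[of "c z - c y" "c y - c w"] by (simp add: algebra_simps)
  qed
  have B0: "0 \<le> B" by (simp add: B_def)
  have "cmod (c z - c w) \<le> B * (1 + cmod (z - w) / r)" for z w
  proof -
    let ?n = "nat \<lceil>cmod (z - w) / r\<rceil>"
    have "real ?n = of_int \<lceil>cmod (z - w) / r\<rceil>"
      using r by (simp add: order.trans[OF _ divide_nonneg_pos])
    then have n: "cmod (z - w) / r \<le> real ?n" "real ?n \<le> 1 + cmod (z - w) / r"
      by linarith+
    have "cmod (c z - c w) \<le> real ?n * B"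
      using n(1) r by (intro chain) (simp only: pos_divide_le_eq)
    also have "\<dots> \<le> (1 + cmod (z - w) / r) * B"
      using n(2) B0 by (rule mult_right_mono)
    finally show ?thesis by (simp add: mult.commute)
  qed
  with B0 show ?thesis by (rule that)
qed

text \<open>
  By \<open>disc_center_diff\<close> the \<open>L^p\<close> distance of \<open>g\<close> to \<open>c w\<close> on the disc around \<open>y\<close> grows at most
  linearly in \<open>|y - w|\<close>, hence its \<open>p\<close>-th power no faster than \<open>exp (|y - w| / 2)\<close>. An integral over the plane is,
  up to the factor \<open>\<pi> r^2\<close>, the integral over all \<open>y\<close> of the integrals over the discs around \<open>y\<close>,
  so no covering of the plane has to be chosen.
\<close>

lemma exponentially_weighted_oscillation:
  fixes g :: "complex \<Rightarrow> complex"
  assumes [measurable]: "g \<in> borel_measurable lebesgue" and p: "1 \<le> p" and r: "0 < r" and N: "0 \<le> N"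
    and osc: "\<And>z. (\<integral>\<^sup>+v\<in>cball z r. ennreal (cmod (g v - c z) powr p) \<partial>lebesgue) \<le> ennreal N"
  obtains E where "0 \<le> E"
    "\<And>w. (\<integral>\<^sup>+z. ennreal (cmod (g z - c w) powr p * exp (- cmod (z - w))) \<partial>lebesgue) \<le> ennreal E"
proof -
  have [measurable]: "cball z s \<in> sets (lebesgue :: complex measure)" for z s by simp
  obtain B where B: "0 \<le> B" "\<And>z w. cmod (c z - c w) \<le> B * (1 + cmod (z - w) / r)"
    using disc_center_diff[OF assms(1) p r N osc] by blast
  obtain I where I: "0 \<le> I" "\<And>w::complex. (\<integral>\<^sup>+z. ennreal (exp (- (1/2) * cmod (z - w))) \<partial>lebesgue) = ennreal I"
    using nn_integral_exp_dist_finite[of "1/2"] by auto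
  define A where "A = 2 powr p * (N + B powr p * (exp (r / 2) * (p / (r / 2)) powr p) * (pi * r\<^sup>2))"
  have A0: "0 \<le> A" using N by (simp add: A_def)
  have disc: "(\<integral>\<^sup>+z\<in>cball y r. ennreal (cmod (g z - c w) powr p) \<partial>lebesgue) \<le> ennreal (A * exp (cmod (y - w) / 2))" for y w
  proof -
    let ?e = "exp (cmod (y - w) / 2)"
    let ?d = "cmod (c y - c w) powr p"
    have "?d \<le> (B * (1 + cmod (y - w) / r)) powr p"
      using B p by (intro powr_mono2) auto
    also have "\<dots> = B powr p * (1 + cmod (y - w) / r) powr p"
      by (rule powr_mult)
    also have "\<dots> \<le> B powr p * (exp (r / 2) * (p / (r / 2)) powr p * exp (r / 2 * (cmod (y - w) / r)))"
      using p r by (intro mult_left_mono powr_le_exp) auto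
    also have "r / 2 * (cmod (y - w) / r) = cmod (y - w) / 2" using r by simp
    finally have d: "?d \<le> B powr p * (exp (r / 2) * (p / (r / 2)) powr p) * ?e"
      by (simp add: mult.assoc)
    have "(\<integral>\<^sup>+z\<in>cball y r. ennreal (cmod (g z - c w) powr p) \<partial>lebesgue)
      \<le> (\<integral>\<^sup>+z. ennreal (2 powr p) * (ennreal (cmod (g z - c y) powr p) * indicator (cball y r) z + ennreal ?d * indicator (cball y r) z) \<partial>lebesgue)"
    proof (rule nn_integral_mono)
      fix z :: complex
      have "cmod (g z - c w) powr p \<le> 2 powr p * (cmod (g z - c y) powr p + ?d)"
        using norm_diff_powr_le[of p "g z" "c w" "c y"] p by (simp add: norm_minus_commute)
      then have "ennreal (cmod (g z - c w) powr p) \<le> ennreal (2 powr p) * (ennreal (cmod (g z - c y) powr p) + ennreal ?d)"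
        by (simp add: ennreal_leI flip: ennreal_mult ennreal_plus)
      from mult_right_mono[OF this, of "indicator (cball y r) z"]
      show "ennreal (cmod (g z - c w) powr p) * indicator (cball y r) z
        \<le> ennreal (2 powr p) * (ennreal (cmod (g z - c y) powr p) * indicator (cball y r) z + ennreal ?d * indicator (cball y r) z)"
        by (simp add: algebra_simps)
    qed
    also have "\<dots> = ennreal (2 powr p) * ((\<integral>\<^sup>+z\<in>cball y r. ennreal (cmod (g z - c y) powr p) \<partial>lebesgue) + ennreal ?d * ennreal (pi * r\<^sup>2))"
      using r by (subst nn_integral_cmult, measurable, subst nn_integral_add)
        (simp_all add: nn_integral_cmult_indicator emeasure_cball unit_ball_vol_2 ennreal_mult power2_eq_square)
    also have "\<dots> \<le> ennreal (2 powr p) * (ennreal (N * ?e) + ennreal (B powr p * (exp (r / 2) * (p / (r / 2)) powr p) * ?e) * ennreal (pi * r\<^sup>2))"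
    proof (intro mult_left_mono add_mono mult_right_mono)
      have "N * 1 \<le> N * ?e" using N by (intro mult_left_mono) auto
      then show "(\<integral>\<^sup>+z\<in>cball y r. ennreal (cmod (g z - c y) powr p) \<partial>lebesgue) \<le> ennreal (N * ?e)"
        using osc[of y] by (simp add: order.trans[OF _ ennreal_leI])
    qed (use d in \<open>auto intro!: ennreal_leI\<close>)
    also have "\<dots> = ennreal (A * ?e)"
      using N by (simp add: A_def algebra_simps flip: ennreal_mult ennreal_plus)
    finally show ?thesis .
  qed
  define E where "E = exp r * A * I / (pi * r\<^sup>2)"
  have "(\<integral>\<^sup>+z. ennreal (cmod (g z - c w) powr p * exp (- cmod (z - w))) \<partial>lebesgue) \<le> ennreal E" for w
  proof -
    let ?\<phi> = "\<lambda>z. cmod (g z - c w) powr p * exp (- cmod (z - w))"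
    have "(\<integral>\<^sup>+z. ennreal (?\<phi> z) \<partial>lebesgue) * ennreal (pi * r\<^sup>2)
        = (\<integral>\<^sup>+z. \<integral>\<^sup>+y. ennreal (?\<phi> z) * indicator (cball z r) y \<partial>lebesgue \<partial>lebesgue)"
    proof (subst nn_integral_multc[symmetric])
      show "(\<lambda>z. ennreal (?\<phi> z)) \<in> borel_measurable lebesgue"
        using borel_measurable_id_lebesgue[where 'a=complex] by measurable
      show "(\<integral>\<^sup>+z. ennreal (?\<phi> z) * ennreal (pi * r\<^sup>2) \<partial>lebesgue) = (\<integral>\<^sup>+z. \<integral>\<^sup>+y. ennreal (?\<phi> z) * indicator (cball z r) y \<partial>lebesgue \<partial>lebesgue)"
        using r by (subst nn_integral_cmult_indicator) (simp_all add: emeasure_cball unit_ball_vol_2 ennreal_mult power2_eq_square)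
    qed
    \<comment> \<open>The disc is written as a section of a subset of the product, so that the integrand is
      visibly measurable in both variables together.\<close>
    also have "\<dots> \<le> (\<integral>\<^sup>+z. \<integral>\<^sup>+y. ennreal (exp r * exp (- cmod (y - w))) * (ennreal (cmod (g z - c w) powr p) * indicator {x. dist (fst x) (snd x) \<le> r} (z, y)) \<partial>lebesgue \<partial>lebesgue)"
    proof (intro nn_integral_mono)
      fix z y :: complex
      show "ennreal (?\<phi> z) * indicator (cball z r) y
        \<le> ennreal (exp r * exp (- cmod (y - w))) * (ennreal (cmod (g z - c w) powr p) * indicator {x. dist (fst x) (snd x) \<le> r} (z, y))"
      proof (cases "dist z y \<le> r")
        case True
        have "cmod (y - w) \<le> r + cmod (z - w)"
          using dist_triangle[of y w z] True by (simp add: dist_norm norm_minus_commute)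
        then have "exp (- cmod (z - w)) \<le> exp r * exp (- cmod (y - w))" by (simp flip: exp_add)
        then have "?\<phi> z \<le> cmod (g z - c w) powr p * (exp r * exp (- cmod (y - w)))"
          by (rule mult_left_mono) simp
        then show ?thesis using True by (simp add: mult_ac ennreal_leI flip: ennreal_mult)
      qed auto
    qed
    also have "\<dots> = (\<integral>\<^sup>+y. \<integral>\<^sup>+z. ennreal (exp r * exp (- cmod (y - w))) * (ennreal (cmod (g z - c w) powr p) * indicator {x. dist (fst x) (snd x) \<le> r} (z, y)) \<partial>lebesgue \<partial>lebesgue)"
      by (rule lebesgue_Tonelli) measurable
    also have "\<dots> = (\<integral>\<^sup>+y. ennreal (exp r * exp (- cmod (y - w))) * (\<integral>\<^sup>+z\<in>cball y r. ennreal (cmod (g z - c w) powr p) \<partial>lebesgue) \<partial>lebesgue)"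
    proof (intro nn_integral_cong)
      fix y :: complex
      have ind: "indicator {x. dist (fst x) (snd x) \<le> r} (z, y) = (indicator (cball y r) z :: ennreal)" for z
        by (simp add: indicator_def dist_commute)
      show "(\<integral>\<^sup>+z. ennreal (exp r * exp (- cmod (y - w))) * (ennreal (cmod (g z - c w) powr p) * indicator {x. dist (fst x) (snd x) \<le> r} (z, y)) \<partial>lebesgue)
        = ennreal (exp r * exp (- cmod (y - w))) * (\<integral>\<^sup>+z\<in>cball y r. ennreal (cmod (g z - c w) powr p) \<partial>lebesgue)"
        unfolding ind by (rule nn_integral_cmult) measurable
    qed
    also have "\<dots> \<le> (\<integral>\<^sup>+y. ennreal (exp r * exp (- cmod (y - w))) * ennreal (A * exp (cmod (y - w) / 2)) \<partial>lebesgue)"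
      by (intro nn_integral_mono mult_left_mono disc) auto
    also have "\<dots> = (\<integral>\<^sup>+y. ennreal (exp r * A) * ennreal (exp (- (1 / 2) * cmod (y - w))) \<partial>lebesgue)"
    proof (intro nn_integral_cong)
      fix y :: complex
      have "exp (- cmod (y - w)) * exp (cmod (y - w) / 2) = exp (- (1 / 2) * cmod (y - w))"
        by (simp flip: exp_add)
      then show "ennreal (exp r * exp (- cmod (y - w))) * ennreal (A * exp (cmod (y - w) / 2))
        = ennreal (exp r * A) * ennreal (exp (- (1 / 2) * cmod (y - w)))"
        using A0 by (simp add: mult_ac flip: ennreal_mult)
    qed
    also have "\<dots> = ennreal (exp r * A) * ennreal I"
    proof (subst nn_integral_cmult)
      show "(\<lambda>y. ennreal (exp (- (1 / 2) * cmod (y - w)))) \<in> borel_measurable lebesgue"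
        using borel_measurable_id_lebesgue[where 'a=complex] by measurable
    qed (simp only: I(2))
    finally have "(\<integral>\<^sup>+z. ennreal (?\<phi> z) \<partial>lebesgue) * ennreal (pi * r\<^sup>2) * ennreal (1 / (pi * r\<^sup>2))
        \<le> ennreal (exp r * A) * ennreal I * ennreal (1 / (pi * r\<^sup>2))"
      by (rule mult_right_mono) simp
    then show ?thesis
      using A0 I r by (simp add: mult.assoc E_def flip: ennreal_mult)
  qed
  moreover have "0 \<le> E" using A0 I by (simp add: E_def)
  ultimately show ?thesis using that by blast
qed

text \<open>
  The constant \<open>c w\<close> is inserted between \<open>g z\<close> and \<open>g v\<close>. As \<open>v\<close> lies in the disc around \<open>w\<close>, the
  weight may be centred at \<open>w\<close> for the term with \<open>g z\<close>, and \<open>exponentially_weighted_oscillation\<close>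
  applies; the term with \<open>g v\<close> is covered by the assumption on the disc around \<open>w\<close>.
\<close>

lemma double_oscillation:
  fixes g :: "complex \<Rightarrow> complex"
  assumes [measurable]: "g \<in> borel_measurable lebesgue" and p: "1 \<le> p" and r: "0 < r" and N: "0 \<le> N"
    and osc: "\<And>z. (\<integral>\<^sup>+v\<in>cball z r. ennreal (cmod (g v - c z) powr p) \<partial>lebesgue) \<le> ennreal N"
  obtains C where "0 \<le> C"
    "\<And>w. (\<integral>\<^sup>+v\<in>cball w r. (\<integral>\<^sup>+z. ennreal (cmod (g z - g v) powr p * exp (- cmod (z - v))) \<partial>lebesgue) \<partial>lebesgue) \<le> ennreal C"
proof -
  have [measurable]: "cball z s \<in> sets (lebesgue :: complex measure)" for z s by simp
  obtain E where E: "0 \<le> E"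
    "\<And>w. (\<integral>\<^sup>+z. ennreal (cmod (g z - c w) powr p * exp (- cmod (z - w))) \<partial>lebesgue) \<le> ennreal E"
    using exponentially_weighted_oscillation[OF assms(1) p r N osc] by blast
  obtain I where I: "0 \<le> I" "\<And>w::complex. (\<integral>\<^sup>+z. ennreal (exp (- 1 * cmod (z - w))) \<partial>lebesgue) = ennreal I"
    using nn_integral_exp_dist_finite[of 1] by auto
  have meas: "(\<lambda>z. exp (- cmod (z - w))) \<in> borel_measurable lebesgue" for w :: complex
    using borel_measurable_id_lebesgue[where 'a=complex] by measurable
  note [measurable] = meas
  define C where "C = 2 powr p * (exp r * E * (pi * r\<^sup>2) + I * N)"
  have inner: "(\<integral>\<^sup>+z. ennreal (cmod (g z - g v) powr p * exp (- cmod (z - v))) \<partial>lebesgue)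
      \<le> ennreal (2 powr p) * (ennreal (exp r * E) + ennreal I * ennreal (cmod (g v - c w) powr p))"
    if v: "v \<in> cball w r" for v w
  proof -
    have "(\<integral>\<^sup>+z. ennreal (cmod (g z - g v) powr p * exp (- cmod (z - v))) \<partial>lebesgue)
      \<le> (\<integral>\<^sup>+z. ennreal (2 powr p) * (ennreal (exp r) * ennreal (cmod (g z - c w) powr p * exp (- cmod (z - w)))
            + ennreal (exp (- cmod (z - v))) * ennreal (cmod (g v - c w) powr p)) \<partial>lebesgue)"
    proof (rule nn_integral_mono)
      fix z :: complex
      have "cmod (z - w) \<le> r + cmod (z - v)"
        using dist_triangle[of z w v] v by (simp add: dist_norm norm_minus_commute)
      then have e: "exp (- cmod (z - v)) \<le> exp r * exp (- cmod (z - w))" by (simp flip: exp_add)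
      have "cmod (g z - g v) powr p * exp (- cmod (z - v))
        \<le> 2 powr p * (cmod (g z - c w) powr p + cmod (g v - c w) powr p) * exp (- cmod (z - v))"
        using p by (intro mult_right_mono norm_diff_powr_le) auto
      also have "\<dots> = 2 powr p * (cmod (g z - c w) powr p * exp (- cmod (z - v)) + cmod (g v - c w) powr p * exp (- cmod (z - v)))"
        by (simp add: algebra_simps)
      also have "\<dots> \<le> 2 powr p * (cmod (g z - c w) powr p * (exp r * exp (- cmod (z - w))) + cmod (g v - c w) powr p * exp (- cmod (z - v)))"
        using e by (intro mult_left_mono add_mono order.refl) auto
      finally show "ennreal (cmod (g z - g v) powr p * exp (- cmod (z - v)))
        \<le> ennreal (2 powr p) * (ennreal (exp r) * ennreal (cmod (g z - c w) powr p * exp (- cmod (z - w)))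
            + ennreal (exp (- cmod (z - v))) * ennreal (cmod (g v - c w) powr p))"
        by (simp add: mult_ac ennreal_leI flip: ennreal_mult ennreal_plus)
    qed
    also have "\<dots> = ennreal (2 powr p) * (ennreal (exp r) * (\<integral>\<^sup>+z. ennreal (cmod (g z - c w) powr p * exp (- cmod (z - w))) \<partial>lebesgue)
        + (\<integral>\<^sup>+z. ennreal (exp (- cmod (z - v))) \<partial>lebesgue) * ennreal (cmod (g v - c w) powr p))"
      by (simp add: nn_integral_cmult nn_integral_add nn_integral_multc)
    also have "\<dots> \<le> ennreal (2 powr p) * (ennreal (exp r) * ennreal E + ennreal I * ennreal (cmod (g v - c w) powr p))"
      using I(2)[of v] by (intro mult_left_mono add_mono E) auto
    finally show ?thesis using E by (simp add: ennreal_mult)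
  qed
  have "(\<integral>\<^sup>+v\<in>cball w r. (\<integral>\<^sup>+z. ennreal (cmod (g z - g v) powr p * exp (- cmod (z - v))) \<partial>lebesgue) \<partial>lebesgue) \<le> ennreal C" for w
  proof -
    have "(\<integral>\<^sup>+v\<in>cball w r. (\<integral>\<^sup>+z. ennreal (cmod (g z - g v) powr p * exp (- cmod (z - v))) \<partial>lebesgue) \<partial>lebesgue)
      \<le> (\<integral>\<^sup>+v. ennreal (2 powr p) * (ennreal (exp r * E) * indicator (cball w r) v + ennreal I * (ennreal (cmod (g v - c w) powr p) * indicator (cball w r) v)) \<partial>lebesgue)"
      using inner[of _ w] by (intro nn_integral_mono) (auto simp: indicator_def)
    also have "\<dots> = ennreal (2 powr p) * (ennreal (exp r * E) * ennreal (pi * r\<^sup>2)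
        + ennreal I * (\<integral>\<^sup>+v\<in>cball w r. ennreal (cmod (g v - c w) powr p) \<partial>lebesgue))"
      using r by (simp add: nn_integral_cmult nn_integral_add emeasure_cball unit_ball_vol_2 ennreal_mult power2_eq_square)
    also have "\<dots> \<le> ennreal (2 powr p) * (ennreal (exp r * E) * ennreal (pi * r\<^sup>2) + ennreal I * ennreal N)"
      by (intro mult_left_mono add_mono osc) auto
    also have "\<dots> = ennreal C"
      using E I N by (simp add: C_def flip: ennreal_mult ennreal_plus)
    finally show ?thesis .
  qed
  moreover have "0 \<le> C" using E I N by (simp add: C_def)
  ultimately show ?thesis using that by blast
qed

text \<open>
  Once \<open>(F v)^p\<close> is replaced by the integral of \<open>(F w)^p\<close> over the disc around \<open>v\<close>, the variable \<open>w\<close>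
  can be integrated last; for fixed \<open>w\<close>, the integrals over \<open>z\<close> and \<open>v\<close> are those bounded by \<open>C\<close>.
\<close>

lemma oscillation_Tonelli:
  fixes g :: "complex \<Rightarrow> complex" and F :: "complex \<Rightarrow> real"
  assumes [measurable]: "g \<in> borel_measurable lebesgue" "F \<in> borel_measurable lebesgue"
    and F: "\<And>v. 0 \<le> F v"
    and C: "\<And>w. (\<integral>\<^sup>+v\<in>cball w r. (\<integral>\<^sup>+z. ennreal (cmod (g z - g v) powr p * exp (- cmod (z - v))) \<partial>lebesgue) \<partial>lebesgue) \<le> C"
    and S: "\<And>v. ennreal (F v powr p) \<le> S * (\<integral>\<^sup>+w\<in>cball v r. ennreal (F w powr p) \<partial>lebesgue)"
  shows "(\<integral>\<^sup>+z. \<integral>\<^sup>+v. ennreal ((cmod (g z - g v) * F v) powr p * exp (- cmod (z - v))) \<partial>lebesgue \<partial>lebesgue)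
    \<le> S * C * (\<integral>\<^sup>+w. ennreal (F w powr p) \<partial>lebesgue)"
proof -
  have [measurable]: "cball z s \<in> sets (lebesgue :: complex measure)" for z s by simp
  interpret sigma_finite_measure "lebesgue :: complex measure" by (rule sigma_finite_lebesgue)
  let ?J = "\<lambda>v. \<integral>\<^sup>+z. ennreal (cmod (g z - g v) powr p * exp (- cmod (z - v))) \<partial>lebesgue"
  let ?ind = "indicator {x. dist (fst x) (snd x) \<le> r} :: complex \<times> complex \<Rightarrow> ennreal"
  have [measurable]: "?J \<in> borel_measurable lebesgue" by measurable
  have [measurable]: "(\<lambda>z. exp (- cmod (z - v))) \<in> borel_measurable lebesgue" for v :: complex
    using borel_measurable_id_lebesgue[where 'a=complex] by measurable
  have "(\<integral>\<^sup>+z. \<integral>\<^sup>+v. ennreal ((cmod (g z - g v) * F v) powr p * exp (- cmod (z - v))) \<partial>lebesgue \<partial>lebesgue)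
     = (\<integral>\<^sup>+v. \<integral>\<^sup>+z. ennreal ((cmod (g z - g v) * F v) powr p * exp (- cmod (z - v))) \<partial>lebesgue \<partial>lebesgue)"
    by (rule lebesgue_Tonelli) measurable
  also have "\<dots> = (\<integral>\<^sup>+v. ennreal (F v powr p) * ?J v \<partial>lebesgue)"
  proof (intro nn_integral_cong)
    fix v :: complex
    have "(\<integral>\<^sup>+z. ennreal ((cmod (g z - g v) * F v) powr p * exp (- cmod (z - v))) \<partial>lebesgue)
      = (\<integral>\<^sup>+z. ennreal (F v powr p) * ennreal (cmod (g z - g v) powr p * exp (- cmod (z - v))) \<partial>lebesgue)"
      using F by (intro nn_integral_cong) (simp add: powr_mult mult_ac flip: ennreal_mult)
    also have "\<dots> = ennreal (F v powr p) * ?J v"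
      by (rule nn_integral_cmult) measurable
    finally show "(\<integral>\<^sup>+z. ennreal ((cmod (g z - g v) * F v) powr p * exp (- cmod (z - v))) \<partial>lebesgue) = ennreal (F v powr p) * ?J v" .
  qed
  also have "\<dots> \<le> (\<integral>\<^sup>+v. S * (\<integral>\<^sup>+w\<in>cball v r. ennreal (F w powr p) \<partial>lebesgue) * ?J v \<partial>lebesgue)"
    by (intro nn_integral_mono mult_right_mono S) auto
  also have "\<dots> = (\<integral>\<^sup>+v. \<integral>\<^sup>+w. S * (ennreal (F w powr p) * ?ind (w, v)) * ?J v \<partial>lebesgue \<partial>lebesgue)"
  proof (intro nn_integral_cong)
    fix v :: complex
    have ind: "?ind (w, v) = indicator (cball v r) w" for w by (simp add: indicator_def dist_commute)
    show "S * (\<integral>\<^sup>+w\<in>cball v r. ennreal (F w powr p) \<partial>lebesgue) * ?J v = (\<integral>\<^sup>+w. S * (ennreal (F w powr p) * ?ind (w, v)) * ?J v \<partial>lebesgue)"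
      unfolding ind by (simp add: nn_integral_cmult nn_integral_multc)
  qed
  also have "\<dots> = (\<integral>\<^sup>+w. \<integral>\<^sup>+v. S * (ennreal (F w powr p) * ?ind (w, v)) * ?J v \<partial>lebesgue \<partial>lebesgue)"
    by (rule lebesgue_Tonelli) measurable
  also have "\<dots> = (\<integral>\<^sup>+w. S * ennreal (F w powr p) * (\<integral>\<^sup>+v\<in>cball w r. ?J v \<partial>lebesgue) \<partial>lebesgue)"
  proof (intro nn_integral_cong)
    fix w :: complex
    have ind: "?ind (w, v) = indicator (cball w r) v" for v by (simp add: indicator_def)
    show "(\<integral>\<^sup>+v. S * (ennreal (F w powr p) * ?ind (w, v)) * ?J v \<partial>lebesgue) = S * ennreal (F w powr p) * (\<integral>\<^sup>+v\<in>cball w r. ?J v \<partial>lebesgue)"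
      unfolding ind by (subst nn_integral_cmult[symmetric]) (auto simp: mult_ac)
  qed
  also have "\<dots> \<le> (\<integral>\<^sup>+w. S * ennreal (F w powr p) * C \<partial>lebesgue)"
    by (intro nn_integral_mono mult_left_mono C) auto
  also have "\<dots> = S * C * (\<integral>\<^sup>+w. ennreal (F w powr p) \<partial>lebesgue)"
    by (subst nn_integral_cmult[symmetric]) (auto simp: mult_ac)
  finally show ?thesis .
qed

section \<open>Decay of the weighted kernel\<close>

lemma summable_kernel:
  fixes \<zeta> :: complex
  shows "summable (\<lambda>k. fact m / fact (k + m) * \<zeta> ^ k)"
proof (rule summable_comparison_test')
  show "summable (\<lambda>k. fact m * (inverse (fact k) * cmod \<zeta> ^ k))"
    by (intro summable_mult summable_exp)
  show "norm (fact m / fact (k + m) * \<zeta> ^ k) \<le> fact m * (inverse (fact k) * cmod \<zeta> ^ k)" for k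
  proof -
    have "fact m / fact (k + m) \<le> fact m * inverse (fact k :: real)"
      by (simp add: divide_inverse fact_mono le_imp_inverse_le)
    then have "fact m / fact (k + m) * cmod \<zeta> ^ k \<le> fact m * inverse (fact k) * cmod \<zeta> ^ k"
      by (rule mult_right_mono) simp
    then show ?thesis by (simp add: norm_mult norm_divide norm_power mult.assoc)
  qed
qed

text \<open>
  The kernel is the exponential series with its first \<open>m\<close> terms removed and the indices shifted.
\<close>

lemma kernel_times_power:
  "kernel m z v * (cnj z * v) ^ m
    = fact m * (exp (cnj z * v) - (\<Sum>j<m. (cnj z * v) ^ j / fact j))"
proof -
  let ?\<zeta> = "cnj z * v"
  have "(\<lambda>n. ?\<zeta> ^ n / fact n) sums exp ?\<zeta>"
    using exp_converges[of ?\<zeta>] by (simp add: scaleR_conv_of_real divide_inverse mult.commute)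
  then have "(\<lambda>k. fact m * (?\<zeta> ^ (k + m) / fact (k + m))) sums (fact m * (exp ?\<zeta> - (\<Sum>j<m. ?\<zeta> ^ j / fact j)))"
    by (intro sums_mult sums_split_initial_segment)
  moreover have "(\<lambda>k. fact m * (?\<zeta> ^ (k + m) / fact (k + m))) sums (kernel m z v * ?\<zeta> ^ m)"
    using sums_mult2[OF summable_sums[OF summable_kernel[of m ?\<zeta>]], of "?\<zeta> ^ m"]
    by (simp add: kernel_def power_add mult_ac)
  ultimately show ?thesis by (rule sums_unique2[rotated])
qed

text \<open>
  The exponential in \<open>kernel_times_power\<close> contributes \<open>m! exp (-|z - v|^2 / 2)\<close>. The finitely
  many subtracted powers of \<open>|z| |v|\<close> are damped by the Gaussian weights to a multiple of
  \<open>exp (-|z| - |v|)\<close>, which is at most \<open>exp (-|z - v|)\<close>. A simple exponential is preferred to a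
  Gaussian as majorant because moving its centre by \<open>r\<close> costs only the factor \<open>exp r\<close>.
\<close>

lemma kernel_decay:
  obtains D where "0 \<le> D"
    "\<And>z v. cmod (kernel m z v) * (cmod z ^ m * exp (- (cmod z)\<^sup>2 / 2)) * (cmod v ^ m * exp (- (cmod v)\<^sup>2 / 2))
        \<le> D * exp (- cmod (z - v))"
proof -
  define D :: real where "D = fact m * (exp (1 / 2) + (\<Sum>j<m. fact j * exp 4))"
  have gauss: "exp (- t\<^sup>2 / 2) \<le> exp (1 / 2) * exp (- t)" for t :: real
  proof -
    \<comment> \<open>Completing the square in \<open>t^2 / 2 - t + 1 / 2\<close>.\<close>
    have "0 \<le> (t - 1)\<^sup>2" by simp
    then show ?thesis by (simp add: power2_eq_square algebra_simps flip: exp_add)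
  qed
  have mono: "t ^ j * exp (- t\<^sup>2 / 2) \<le> fact j * exp 2 * exp (- t)" if "0 \<le> t" for t :: real and j
  proof -
    have "inverse (fact j) *\<^sub>R t ^ j = (\<Sum>i\<in>{j}. inverse (fact i) *\<^sub>R t ^ i)" by simp
    also have "\<dots> \<le> exp t"
      unfolding exp_def by (rule sum_le_suminf) (use that summable_exp[of t] in auto)
    finally have "t ^ j \<le> fact j * exp t" by (simp add: field_simps)
    then have "t ^ j * exp (- t\<^sup>2 / 2) \<le> fact j * exp t * exp (- t\<^sup>2 / 2)" by (rule mult_right_mono) simp
    also have "\<dots> = fact j * (exp t * exp (- t\<^sup>2 / 2))" by simp
    also have "exp t * exp (- t\<^sup>2 / 2) \<le> exp 2 * exp (- t)"
    proof -
      have "0 \<le> (t - 2)\<^sup>2" by simp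
      then show ?thesis by (simp add: power2_eq_square algebra_simps flip: exp_add)
    qed
    finally show ?thesis by (simp add: mult.assoc mult_left_mono)
  qed
  have "cmod (kernel m z v) * (cmod z ^ m * exp (- (cmod z)\<^sup>2 / 2)) * (cmod v ^ m * exp (- (cmod v)\<^sup>2 / 2))
        \<le> D * exp (- cmod (z - v))" for z v
  proof -
    let ?e = "exp (- (cmod z)\<^sup>2 / 2) * exp (- (cmod v)\<^sup>2 / 2)"
    have "cmod (kernel m z v) * (cmod z ^ m * exp (- (cmod z)\<^sup>2 / 2)) * (cmod v ^ m * exp (- (cmod v)\<^sup>2 / 2))
      = cmod (kernel m z v * (cnj z * v) ^ m) * ?e"
      by (simp add: norm_mult norm_power power_mult_distrib)
    also have "\<dots> = fact m * cmod (exp (cnj z * v) - (\<Sum>j<m. (cnj z * v) ^ j / fact j)) * ?e"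
      by (simp add: kernel_times_power norm_mult)
    also have "\<dots> \<le> fact m * (cmod (exp (cnj z * v)) + (\<Sum>j<m. cmod ((cnj z * v) ^ j / fact j))) * ?e"
      by (intro mult_right_mono mult_left_mono order.trans[OF norm_triangle_ineq4] add_left_mono sum_norm_le) auto
    also have "\<dots> = fact m * (exp (Re (cnj z * v)) * ?e
        + (\<Sum>j<m. (cmod z ^ j * exp (- (cmod z)\<^sup>2 / 2)) * (cmod v ^ j * exp (- (cmod v)\<^sup>2 / 2)) / fact j))"
    proof -
      have "(\<Sum>j<m. cmod ((cnj z * v) ^ j / fact j)) * ?e
        = (\<Sum>j<m. (cmod z ^ j * exp (- (cmod z)\<^sup>2 / 2)) * (cmod v ^ j * exp (- (cmod v)\<^sup>2 / 2)) / fact j)"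
        unfolding sum_distrib_right by (simp add: norm_mult norm_divide norm_power power_mult_distrib mult_ac)
      then show ?thesis by (simp only: mult.assoc distrib_right norm_exp_eq_Re)
    qed
    also have "\<dots> \<le> fact m * (exp (1 / 2) * exp (- cmod (z - v)) + (\<Sum>j<m. fact j * exp 4 * exp (- cmod (z - v))))"
    proof (intro mult_left_mono add_mono sum_mono)
      have "Re (cnj z * v) - (cmod z)\<^sup>2 / 2 - (cmod v)\<^sup>2 / 2 = - (cmod (z - v))\<^sup>2 / 2"
        by (simp add: cmod_power2) (simp add: power2_eq_square field_simps)
      then have "exp (Re (cnj z * v)) * ?e = exp (- (cmod (z - v))\<^sup>2 / 2)"
        by (simp add: algebra_simps flip: exp_add)
      then show "exp (Re (cnj z * v)) * ?e \<le> exp (1 / 2) * exp (- cmod (z - v))"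
        using gauss by simp
    next
      fix j
      have "(cmod z ^ j * exp (- (cmod z)\<^sup>2 / 2)) * (cmod v ^ j * exp (- (cmod v)\<^sup>2 / 2)) / fact j
        \<le> (fact j * exp 2 * exp (- cmod z)) * (fact j * exp 2 * exp (- cmod v)) / fact j"
        by (intro divide_right_mono mult_mono mono) auto
      also have "\<dots> = fact j * (exp 4 * exp (- cmod z - cmod v))"
        by (simp add: exp_diff exp_minus field_simps flip: exp_add)
      also have "\<dots> \<le> fact j * (exp 4 * exp (- cmod (z - v)))"
        using norm_triangle_ineq4[of z v] by (intro mult_left_mono) auto
      finally show "(cmod z ^ j * exp (- (cmod z)\<^sup>2 / 2)) * (cmod v ^ j * exp (- (cmod v)\<^sup>2 / 2)) / fact j
        \<le> fact j * exp 4 * exp (- cmod (z - v))" by (simp add: mult.assoc)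
    qed simp
    also have "\<dots> = D * exp (- cmod (z - v))"
      by (simp add: D_def distrib_left distrib_right sum_distrib_right sum_distrib_left mult_ac)
    finally show ?thesis .
  qed
  moreover have "0 \<le> D" unfolding D_def by (intro mult_nonneg_nonneg add_nonneg_nonneg sum_nonneg) auto
  ultimately show ?thesis using that by blast
qed

section \<open>Weighted moduli of entire functions\<close>

definition weighted_abs :: "nat \<Rightarrow> (complex \<Rightarrow> complex) \<Rightarrow> complex \<Rightarrow> real" where
  "weighted_abs m f v = cmod (f v) * (cmod v ^ m * exp (- (cmod v)\<^sup>2 / 2))"

lemma weighted_abs_nonneg [simp]: "0 \<le> weighted_abs m f v"
  by (simp add: weighted_abs_def)

lemma Lpm_integrand_eq: "Lpm_integrand p m f v = weighted_abs m f v powr p"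
  by (simp add: Lpm_integrand_def weighted_abs_def powr_mult exp_powr_real mult.assoc mult_ac)

text \<open>
  The entire function \<open>G w = f w * w^m * exp (- w cnj v + |v|^2 / 2)\<close> has modulus
  \<open>F w * exp (|w - v|^2 / 2)\<close> with \<open>F\<close> the weighted modulus of \<open>f\<close>: it agrees with \<open>F\<close> at the centre
  \<open>v\<close> and exceeds it at most by a constant factor on the disc. Its mean value property, followed by
  Hoelder's inequality on the disc, gives the claim with a constant that is independent of \<open>f\<close> and
  \<open>v\<close>.
\<close>

lemma weighted_abs_submean:
  assumes p: "1 \<le> p" and r: "0 < r"
  obtains S where "0 \<le> S"
    "\<And>f v. f holomorphic_on UNIV \<Longrightarrow> ennreal (weighted_abs m f v powr p)
        \<le> ennreal S * (\<integral>\<^sup>+w\<in>cball v r. ennreal (weighted_abs m f w powr p) \<partial>lebesgue)"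
proof -
  define S where "S = (exp (r\<^sup>2 / 2) / (pi * r\<^sup>2)) powr p * (pi * r\<^sup>2) powr (p - 1)"
  have "ennreal (weighted_abs m f v powr p)
        \<le> ennreal S * (\<integral>\<^sup>+w\<in>cball v r. ennreal (weighted_abs m f w powr p) \<partial>lebesgue)"
    if f: "f holomorphic_on UNIV" for f v
  proof -
    let ?B = "cball v r"
    let ?W = "weighted_abs m f"
    have cont: "continuous_on UNIV ?W"
      unfolding weighted_abs_def using holomorphic_on_imp_continuous_on[OF f] by (intro continuous_intros) auto
    have [measurable]: "?W \<in> borel_measurable borel" using cont by (rule borel_measurable_continuous_onI)
    have [measurable]: "?B \<in> sets borel" by simp
    define G where "G w = f w * w ^ m * exp (- w * cnj v + of_real ((cmod v)\<^sup>2 / 2))" for w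
    have G: "G holomorphic_on UNIV"
      unfolding G_def using f by (intro holomorphic_intros)
    have Gw: "cmod (G w) = ?W w * exp ((cmod (w - v))\<^sup>2 / 2)" for w
    proof -
      have "Re (- w * cnj v + of_real ((cmod v)\<^sup>2 / 2)) = - (cmod w)\<^sup>2 / 2 + (cmod (w - v))\<^sup>2 / 2"
        by (simp add: cmod_power2) (simp add: power2_eq_square field_simps)
      then show ?thesis
        by (simp add: G_def weighted_abs_def norm_mult norm_power mult.assoc flip: exp_add)
    qed
    have int: "integrable lborel (\<lambda>w. ?W w * indicator ?B w)" and intp: "integrable lborel (\<lambda>w. ?W w powr p * indicator ?B w)"
    proof -
      have "continuous_on ?B ?W" using cont by (rule continuous_on_subset) simp
      moreover from this have "continuous_on ?B (\<lambda>w. ?W w powr p)"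
        using p by (intro continuous_on_powr' continuous_on_const) auto
      ultimately show "integrable lborel (\<lambda>w. ?W w * indicator ?B w)" "integrable lborel (\<lambda>w. ?W w powr p * indicator ?B w)"
        using borel_integrable_compact[OF compact_cball, of v r ?W]
          borel_integrable_compact[OF compact_cball, of v r "\<lambda>w. ?W w powr p"]
        by (simp_all add: mult.commute)
    qed
    define T where "T = (\<integral>w. ?W w * indicator ?B w \<partial>lborel)"
    have T0: "0 \<le> T" unfolding T_def by (rule integral_nonneg_AE) simp
    have "ennreal (pi * r\<^sup>2 * ?W v) = ennreal (pi * r\<^sup>2) * ennreal (cmod (G v))"
      by (simp add: Gw ennreal_mult)
    also have "\<dots> \<le> (\<integral>\<^sup>+w\<in>?B. ennreal (cmod (G w)) \<partial>lborel)"
      by (rule disc_mean_value[OF G r])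
    also have "\<dots> \<le> (\<integral>\<^sup>+w. ennreal (exp (r\<^sup>2 / 2)) * ennreal (?W w * indicator ?B w) \<partial>lborel)"
    proof (rule nn_integral_mono)
      fix w
      show "ennreal (cmod (G w)) * indicator ?B w \<le> ennreal (exp (r\<^sup>2 / 2)) * ennreal (?W w * indicator ?B w)"
      proof (cases "w \<in> ?B")
        case True
        then have "(cmod (w - v))\<^sup>2 \<le> r\<^sup>2" by (intro power_mono) (auto simp: dist_norm norm_minus_commute)
        then have "?W w * exp ((cmod (w - v))\<^sup>2 / 2) \<le> ?W w * exp (r\<^sup>2 / 2)" by (intro mult_left_mono) auto
        with True show ?thesis by (simp add: Gw ennreal_leI mult.commute flip: ennreal_mult)
      qed simp
    qed
    also have "\<dots> = ennreal (exp (r\<^sup>2 / 2)) * ennreal T"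
      unfolding T_def by (subst nn_integral_cmult) (simp_all add: nn_integral_eq_integral[OF int])
    finally have "pi * r\<^sup>2 * ?W v \<le> exp (r\<^sup>2 / 2) * T"
      using T0 by (simp flip: ennreal_mult)
    then have "?W v \<le> exp (r\<^sup>2 / 2) / (pi * r\<^sup>2) * T" using r by (simp add: field_simps)
    then have "?W v powr p \<le> (exp (r\<^sup>2 / 2) / (pi * r\<^sup>2) * T) powr p" using p by (intro powr_mono2) auto
    also have "\<dots> = (exp (r\<^sup>2 / 2) / (pi * r\<^sup>2)) powr p * T powr p"
      by (rule powr_mult)
    also have "\<dots> \<le> (exp (r\<^sup>2 / 2) / (pi * r\<^sup>2)) powr p * ((pi * r\<^sup>2) powr (p - 1) * (\<integral>w. ?W w powr p * indicator ?B w \<partial>lborel))"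
      unfolding T_def
    proof (intro mult_left_mono holder_weighted(2)[OF p])
      show "integrable lborel (indicator ?B :: complex \<Rightarrow> real)"
        using r by (simp add: integrable_indicator_iff emeasure_cball)
      show "(\<integral>w. indicator ?B w \<partial>lborel) \<le> pi * r\<^sup>2"
        using r by (simp add: content_cball unit_ball_vol_2)
    qed (use r intp in auto)
    finally have "?W v powr p \<le> S * (\<integral>w. ?W w powr p * indicator ?B w \<partial>lborel)"
      by (simp add: S_def mult.assoc)
    then have "ennreal (?W v powr p) \<le> ennreal (S * (\<integral>w. ?W w powr p * indicator ?B w \<partial>lborel))"
      by (rule ennreal_leI)
    also have "\<dots> = ennreal S * (\<integral>\<^sup>+w. ennreal (?W w powr p * indicator ?B w) \<partial>lborel)"
      by (subst nn_integral_eq_integral[OF intp]) (simp_all add: S_def ennreal_mult integral_nonneg_AE)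
    also have "(\<integral>\<^sup>+w. ennreal (?W w powr p * indicator ?B w) \<partial>lborel) = (\<integral>\<^sup>+w\<in>?B. ennreal (?W w powr p) \<partial>lebesgue)"
      unfolding nn_integral_completion by (intro nn_integral_cong) (auto simp: indicator_def)
    finally show ?thesis .
  qed
  moreover have "0 \<le> S" by (simp add: S_def)
  ultimately show ?thesis using that by blast
qed

section \<open>Hankel operators\<close>

lemma measurable_kernel_pair [measurable]:
  "(\<lambda>x. kernel m (fst x) (snd x)) \<in> borel_measurable ((lebesgue :: complex measure) \<Otimes>\<^sub>M (lebesgue :: complex measure))"
proof -
  have [measurable]: "cnj \<in> borel_measurable borel" by (intro borel_measurable_continuous_onI continuous_intros)
  show ?thesis unfolding kernel_def by measurable
qed

lemma measurable_proj_integrand_pair: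
  assumes [measurable]: "g \<in> borel_measurable lebesgue" "f \<in> borel_measurable lebesgue"
  shows "(\<lambda>x. proj_integrand m (\<lambda>v. (g (fst x) - g v) * f v) (fst x) (snd x))
    \<in> borel_measurable ((lebesgue :: complex measure) \<Otimes>\<^sub>M (lebesgue :: complex measure))"
proof -
  have [measurable]: "cnj \<in> borel_measurable borel" by (intro borel_measurable_continuous_onI continuous_intros)
  show ?thesis unfolding proj_integrand_def by measurable
qed

text \<open>
  The pointwise bound of the weighted modulus of \<open>H_g f\<close> by Hoelder's inequality holds wherever the
  majorant is finite. Its integral over the plane is finite by \<open>oscillation_Tonelli\<close>, so this is the
  case almost everywhere, and both the absolute convergence of the defining integral and the norm
  estimate follow from the same bound.
\<close>

lemma Hankel_estimate:
  fixes g :: "complex \<Rightarrow> complex"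
  assumes g [measurable]: "g \<in> borel_measurable lebesgue" and p: "1 \<le> p" and r: "0 < r" and N: "0 \<le> N"
    and osc: "\<And>z. (\<integral>\<^sup>+v\<in>cball z r. ennreal (cmod (g v - c z) powr p) \<partial>lebesgue) \<le> ennreal N"
  obtains Q where "0 \<le> Q"
    "\<And>f. f \<in> Fock_Sobolev p m \<Longrightarrow>
      AE z in lebesgue. integrable lebesgue (proj_integrand m (\<lambda>v. (g z - g v) * f v) z)"
    "\<And>f. f \<in> Fock_Sobolev p m \<Longrightarrow>
      (\<integral>\<^sup>+z. ennreal (weighted_abs m (Hankel m g f) z powr p) \<partial>lebesgue)
        \<le> ennreal Q * (\<integral>\<^sup>+z. ennreal (weighted_abs m f z powr p) \<partial>lebesgue)"
proof -
  obtain D where D: "0 \<le> D"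
    "\<And>z v. cmod (kernel m z v) * (cmod z ^ m * exp (- (cmod z)\<^sup>2 / 2)) * (cmod v ^ m * exp (- (cmod v)\<^sup>2 / 2))
        \<le> D * exp (- cmod (z - v))"
    using kernel_decay by blast
  obtain S where S: "0 \<le> S"
    "\<And>f v. f holomorphic_on UNIV \<Longrightarrow> ennreal (weighted_abs m f v powr p)
        \<le> ennreal S * (\<integral>\<^sup>+w\<in>cball v r. ennreal (weighted_abs m f w powr p) \<partial>lebesgue)"
    using weighted_abs_submean[OF p r, of m] by blast
  obtain C where C: "0 \<le> C"
    "\<And>w. (\<integral>\<^sup>+v\<in>cball w r. (\<integral>\<^sup>+z. ennreal (cmod (g z - g v) powr p * exp (- cmod (z - v))) \<partial>lebesgue) \<partial>lebesgue) \<le> ennreal C"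
    using double_oscillation[OF g p r N osc] by blast
  obtain I where I: "0 \<le> I" "\<And>w::complex. (\<integral>\<^sup>+z. ennreal (exp (- 1 * cmod (z - w))) \<partial>lebesgue) = ennreal I"
    using nn_integral_exp_dist_finite[of 1] by auto
  \<comment> \<open>An upper bound for the mass of the weight that is certainly positive.\<close>
  define K where "K = I + 1"
  define P where "P = (D / (pi * fact m)) powr p * K powr (p - 1)"
  have P0: "0 \<le> P" by (simp add: P_def)
  let ?I = "\<lambda>f z. \<integral>\<^sup>+v. ennreal ((cmod (g z - g v) * weighted_abs m f v) powr p * exp (- cmod (z - v))) \<partial>lebesgue"
  have kern_int: "integrable lebesgue (\<lambda>v. exp (- cmod (z - v)))" "(\<integral>v. exp (- cmod (z - v)) \<partial>lebesgue) \<le> K" for z :: complex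
  proof -
    have nn: "(\<integral>\<^sup>+v. ennreal (exp (- cmod (z - v))) \<partial>lebesgue) = ennreal I"
      using I(2)[of z] by (simp add: norm_minus_commute)
    have [measurable]: "(\<lambda>v. exp (- cmod (z - v))) \<in> borel_measurable lebesgue"
      using borel_measurable_id_lebesgue[where 'a=complex] by measurable
    show "integrable lebesgue (\<lambda>v. exp (- cmod (z - v)))"
      by (rule integrableI_nonneg) (simp_all add: nn)
    show "(\<integral>v. exp (- cmod (z - v)) \<partial>lebesgue) \<le> K"
      using I by (subst integral_eq_nn_integral) (simp_all add: nn K_def)
  qed
  have pointwise: "integrable lebesgue (proj_integrand m (\<lambda>v. (g z - g v) * f v) z)"
      "ennreal (weighted_abs m (Hankel m g f) z powr p) \<le> ennreal P * ?I f z"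
    if [measurable]: "f \<in> borel_measurable lebesgue" and fin: "?I f z \<noteq> \<infinity>" and z: "z \<noteq> 0" for f z
  proof -
    let ?k = "\<lambda>v. exp (- cmod (z - v))"
    let ?\<phi> = "\<lambda>v. cmod (g z - g v) * weighted_abs m f v"
    let ?h = "proj_integrand m (\<lambda>v. (g z - g v) * f v) z"
    have [measurable]: "?k \<in> borel_measurable lebesgue" "weighted_abs m f \<in> borel_measurable lebesgue"
      unfolding weighted_abs_def using borel_measurable_id_lebesgue[where 'a=complex] by measurable
    have int: "integrable lebesgue (\<lambda>v. ?\<phi> v powr p * ?k v)"
      by (rule integrableI_nonneg) (use fin in \<open>simp_all add: less_top\<close>)
    note H = holder_weighted[OF p kern_int(1)[of z] _ kern_int(2)[of z] _ _ _ int]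
    have intk: "integrable lebesgue (\<lambda>v. ?\<phi> v * ?k v)"
      by (rule H(1)) (use I in \<open>simp_all add: K_def\<close>)
    define T where "T = (\<integral>v. ?\<phi> v * ?k v \<partial>lebesgue)"
    have T0: "0 \<le> T" unfolding T_def by (rule integral_nonneg_AE) simp
    have Tp: "T powr p \<le> K powr (p - 1) * (\<integral>v. ?\<phi> v powr p * ?k v \<partial>lebesgue)"
      unfolding T_def by (rule H(2)) (use I in \<open>simp_all add: K_def\<close>)
    \<comment> \<open>The point \<open>z = 0\<close> is excluded because this weight vanishes there if \<open>m > 0\<close>.\<close>
    define \<omega> where "\<omega> = cmod z ^ m * exp (- (cmod z)\<^sup>2 / 2)"
    have \<omega>: "0 < \<omega>" using z by (simp add: \<omega>_def)
    have bound: "\<omega> * cmod (?h v) \<le> D * (?\<phi> v * ?k v)" for v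
    proof -
      have "\<omega> * cmod (?h v) = ?\<phi> v * (cmod (kernel m z v) * \<omega> * (cmod v ^ m * exp (- (cmod v)\<^sup>2 / 2)))"
      proof -
        have "cmod v ^ (2 * m) = cmod v ^ m * cmod v ^ m"
          unfolding mult_2 by (rule power_add)
        moreover have "exp (- (cmod v)\<^sup>2) = exp (- (cmod v)\<^sup>2 / 2) * exp (- (cmod v)\<^sup>2 / 2)"
          by (simp flip: exp_add)
        ultimately have "cmod v ^ (2 * m) * exp (- (cmod v)\<^sup>2)
            = (cmod v ^ m * exp (- (cmod v)\<^sup>2 / 2)) * (cmod v ^ m * exp (- (cmod v)\<^sup>2 / 2))"
          by (simp only: mult_ac)
        then show ?thesis
          by (simp add: proj_integrand_def norm_mult weighted_abs_def norm_power mult_ac)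
      qed
      also have "\<dots> \<le> ?\<phi> v * (D * ?k v)"
        unfolding \<omega>_def by (intro mult_left_mono D) simp
      finally show ?thesis by (simp add: mult_ac)
    qed
    have "(\<lambda>v. (z, v)) \<in> lebesgue \<rightarrow>\<^sub>M lebesgue \<Otimes>\<^sub>M (lebesgue :: complex measure)" by simp
    from measurable_compose[OF this measurable_proj_integrand_pair[OF g that(1)]]
    have [measurable]: "?h \<in> borel_measurable lebesgue" by simp
    show inth: "integrable lebesgue ?h"
    proof (rule Bochner_Integration.integrable_bound)
      show "integrable lebesgue (\<lambda>v. D / \<omega> * (?\<phi> v * ?k v))" by (intro integrable_mult_right intk)
      show "AE v in lebesgue. cmod (?h v) \<le> norm (D / \<omega> * (?\<phi> v * ?k v))"
        using bound \<omega> D by (intro AE_I2) (simp add: field_simps abs_mult)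
    qed simp
    have "\<omega> * cmod (\<integral>v. ?h v \<partial>lebesgue) \<le> \<omega> * (\<integral>v. cmod (?h v) \<partial>lebesgue)"
      using \<omega> by (intro mult_left_mono integral_norm_bound) simp
    also have "\<dots> = (\<integral>v. \<omega> * cmod (?h v) \<partial>lebesgue)" by simp
    also have "\<dots> \<le> (\<integral>v. D * (?\<phi> v * ?k v) \<partial>lebesgue)"
      using inth intk bound by (intro integral_mono) auto
    also have "\<dots> = D * T" by (simp add: T_def)
    finally have "\<omega> * cmod (\<integral>v. ?h v \<partial>lebesgue) / (pi * fact m) \<le> D * T / (pi * fact m)"
      by (rule divide_right_mono) simp
    moreover have "weighted_abs m (Hankel m g f) z = \<omega> * cmod (\<integral>v. ?h v \<partial>lebesgue) / (pi * fact m)"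
      by (simp add: weighted_abs_def Hankel_def Fock_proj_def \<omega>_def norm_mult norm_divide)
    ultimately have "weighted_abs m (Hankel m g f) z \<le> D / (pi * fact m) * T" by simp
    then have "weighted_abs m (Hankel m g f) z powr p \<le> (D / (pi * fact m) * T) powr p"
      using p by (intro powr_mono2) auto
    also have "\<dots> = (D / (pi * fact m)) powr p * T powr p"
      by (rule powr_mult)
    also have "\<dots> \<le> P * (\<integral>v. ?\<phi> v powr p * ?k v \<partial>lebesgue)"
      unfolding P_def mult.assoc by (intro mult_left_mono Tp) simp
    finally have "ennreal (weighted_abs m (Hankel m g f) z powr p) \<le> ennreal (P * (\<integral>v. ?\<phi> v powr p * ?k v \<partial>lebesgue))"
      by (rule ennreal_leI)
    also have "\<dots> = ennreal P * ?I f z"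
      using P0 by (subst nn_integral_eq_integral[OF int]) (simp_all add: ennreal_mult integral_nonneg_AE)
    finally show "ennreal (weighted_abs m (Hankel m g f) z powr p) \<le> ennreal P * ?I f z" .
  qed
  have AE: "AE z in lebesgue. ?I f z \<noteq> \<infinity> \<and> z \<noteq> 0"
    and I_le: "(\<integral>\<^sup>+z. ?I f z \<partial>lebesgue) \<le> ennreal S * ennreal C * (\<integral>\<^sup>+w. ennreal (weighted_abs m f w powr p) \<partial>lebesgue)"
    and I_meas: "?I f \<in> borel_measurable lebesgue"
    and f_meas: "f \<in> borel_measurable lebesgue"
    if "f \<in> Fock_Sobolev p m" for f
  proof -
    interpret sigma_finite_measure "lebesgue :: complex measure" by (rule sigma_finite_lebesgue)
    have f: "f holomorphic_on UNIV" and [measurable]: "f \<in> borel_measurable lebesgue"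
      and fp: "integrable lebesgue (\<lambda>v. weighted_abs m f v powr p)"
      using that by (auto simp: Fock_Sobolev_def Lpm_def Lpm_integrand_eq[abs_def])
    show "f \<in> borel_measurable lebesgue" by fact
    have [measurable]: "weighted_abs m f \<in> borel_measurable lebesgue"
      unfolding weighted_abs_def using borel_measurable_id_lebesgue[where 'a=complex] by measurable
    show I_meas: "?I f \<in> borel_measurable lebesgue" by measurable
    show I_le: "(\<integral>\<^sup>+z. ?I f z \<partial>lebesgue) \<le> ennreal S * ennreal C * (\<integral>\<^sup>+w. ennreal (weighted_abs m f w powr p) \<partial>lebesgue)"
      by (rule oscillation_Tonelli[OF g _ _ C(2) S(2)[OF f]]) auto
    have "ennreal S * ennreal C * (\<integral>\<^sup>+w. ennreal (weighted_abs m f w powr p) \<partial>lebesgue) < \<infinity>"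
      by (simp add: nn_integral_eq_integral[OF fp] ennreal_mult_less_top)
    with I_le have "(\<integral>\<^sup>+z. ?I f z \<partial>lebesgue) \<noteq> \<infinity>" by (auto simp: top_unique)
    with I_meas have "AE z in lebesgue. ?I f z \<noteq> \<infinity>" by (rule nn_integral_PInf_AE)
    moreover have "AE z::complex in lebesgue. z \<noteq> 0" by (intro AE_completion AE_lborel_singleton)
    ultimately show "AE z in lebesgue. ?I f z \<noteq> \<infinity> \<and> z \<noteq> 0" by simp
  qed
  show thesis
  proof
    show "0 \<le> P * (S * C)" using P0 S C by simp
    fix f assume f: "f \<in> Fock_Sobolev p m"
    show "AE z in lebesgue. integrable lebesgue (proj_integrand m (\<lambda>v. (g z - g v) * f v) z)"
      using AE[OF f] pointwise(1)[OF f_meas[OF f]] by (auto elim: eventually_mono)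
    have "(\<integral>\<^sup>+z. ennreal (weighted_abs m (Hankel m g f) z powr p) \<partial>lebesgue) \<le> (\<integral>\<^sup>+z. ennreal P * ?I f z \<partial>lebesgue)"
      using AE[OF f] pointwise(2)[OF f_meas[OF f]] by (intro nn_integral_mono_AE) (auto elim: eventually_mono)
    also have "\<dots> = ennreal P * (\<integral>\<^sup>+z. ?I f z \<partial>lebesgue)"
      using I_meas[OF f] by (rule nn_integral_cmult)
    also have "\<dots> \<le> ennreal P * (ennreal S * ennreal C * (\<integral>\<^sup>+w. ennreal (weighted_abs m f w powr p) \<partial>lebesgue))"
      by (intro mult_left_mono I_le[OF f]) simp
    also have "\<dots> = ennreal (P * (S * C)) * (\<integral>\<^sup>+w. ennreal (weighted_abs m f w powr p) \<partial>lebesgue)"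
      using P0 S C by (simp add: ennreal_mult mult_ac)
    finally show "(\<integral>\<^sup>+z. ennreal (weighted_abs m (Hankel m g f) z powr p) \<partial>lebesgue)
        \<le> ennreal (P * (S * C)) * (\<integral>\<^sup>+z. ennreal (weighted_abs m f z powr p) \<partial>lebesgue)" .
  qed
qed

lemma Hankel_bounded_of_disc_oscillation:
  fixes g :: "complex \<Rightarrow> complex"
  assumes g [measurable]: "g \<in> borel_measurable lebesgue" and p: "1 \<le> p" and r: "0 < r" and N: "0 \<le> N"
    and osc: "\<And>z. (\<integral>\<^sup>+v\<in>cball z r. ennreal (cmod (g v - c z) powr p) \<partial>lebesgue) \<le> ennreal N"
  shows "Hankel_bounded p m g"
proof -
  obtain Q where Q: "0 \<le> Q"
    and AE: "\<And>f. f \<in> Fock_Sobolev p m \<Longrightarrow>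
      AE z in lebesgue. integrable lebesgue (proj_integrand m (\<lambda>v. (g z - g v) * f v) z)"
    and le: "\<And>f. f \<in> Fock_Sobolev p m \<Longrightarrow>
      (\<integral>\<^sup>+z. ennreal (weighted_abs m (Hankel m g f) z powr p) \<partial>lebesgue)
        \<le> ennreal Q * (\<integral>\<^sup>+z. ennreal (weighted_abs m f z powr p) \<partial>lebesgue)"
    using Hankel_estimate[OF g p r N osc, of m] by blast
  interpret sigma_finite_measure "lebesgue :: complex measure" by (rule sigma_finite_lebesgue)
  have main: "Hankel m g f \<in> Lpm p m \<and> Lpm_norm p m (Hankel m g f) \<le> Q powr (1 / p) * Lpm_norm p m f"
    if f: "f \<in> Fock_Sobolev p m" for f
  proof -
    have fm [measurable]: "f \<in> borel_measurable lebesgue"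
      and fp: "integrable lebesgue (\<lambda>v. weighted_abs m f v powr p)"
      using that by (auto simp: Fock_Sobolev_def Lpm_def Lpm_integrand_eq[abs_def])
    have "(\<lambda>z. \<integral>v. proj_integrand m (\<lambda>v. (g z - g v) * f v) z v \<partial>lebesgue) \<in> borel_measurable lebesgue"
      using measurable_proj_integrand_pair[OF g fm] by (intro borel_measurable_lebesgue_integral) (simp add: case_prod_unfold)
    then have [measurable]: "Hankel m g f \<in> borel_measurable lebesgue"
      unfolding Hankel_def[abs_def] Fock_proj_def by measurable
    have [measurable]: "weighted_abs m (Hankel m g f) \<in> borel_measurable lebesgue"
      unfolding weighted_abs_def using borel_measurable_id_lebesgue[where 'a=complex] by measurable
    have le': "(\<integral>\<^sup>+z. ennreal (weighted_abs m (Hankel m g f) z powr p) \<partial>lebesgue)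
        \<le> ennreal (Q * (\<integral>z. weighted_abs m f z powr p \<partial>lebesgue))"
      using le[OF f] Q by (simp add: nn_integral_eq_integral[OF fp] ennreal_mult integral_nonneg_AE)
    have Hp: "integrable lebesgue (\<lambda>z. weighted_abs m (Hankel m g f) z powr p)"
    proof (rule integrableI_nonneg)
      show "(\<integral>\<^sup>+z. ennreal (weighted_abs m (Hankel m g f) z powr p) \<partial>lebesgue) < \<infinity>"
        using le_less_trans[OF le' ennreal_less_top] by simp
    qed simp_all
    with le' have int_le: "(\<integral>z. weighted_abs m (Hankel m g f) z powr p \<partial>lebesgue) \<le> Q * (\<integral>z. weighted_abs m f z powr p \<partial>lebesgue)"
      using Q by (simp add: nn_integral_eq_integral integral_nonneg_AE)
    have c0: "0 \<le> Lpm_const p m"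
      using p by (auto simp: Lpm_const_def intro!: mult_nonneg_nonneg divide_nonneg_nonneg less_imp_le[OF Gamma_real_pos] add_nonneg_pos)
    have "Lpm_norm p m (Hankel m g f) \<le> (Q * (Lpm_const p m * (\<integral>z. weighted_abs m f z powr p \<partial>lebesgue))) powr (1 / p)"
      unfolding Lpm_norm_def Lpm_integrand_eq using mult_left_mono[OF int_le c0] c0 p
      by (intro powr_mono2) (auto simp: mult_ac intro!: mult_nonneg_nonneg integral_nonneg_AE)
    also have "\<dots> = Q powr (1 / p) * Lpm_norm p m f"
      unfolding Lpm_norm_def Lpm_integrand_eq by (rule powr_mult)
    finally show ?thesis using Hp by (simp add: Lpm_def Lpm_integrand_eq[abs_def])
  qed
  have add: "AE z in lebesgue. Hankel m g (\<lambda>v. f v + h v) z = Hankel m g f z + Hankel m g h z"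
    if "f \<in> Fock_Sobolev p m" "h \<in> Fock_Sobolev p m" for f h
    using AE[OF that(1)] AE[OF that(2)]
  proof eventually_elim
    case (elim z)
    have "proj_integrand m (\<lambda>v. (g z - g v) * (f v + h v)) z
        = (\<lambda>v. proj_integrand m (\<lambda>v. (g z - g v) * f v) z v + proj_integrand m (\<lambda>v. (g z - g v) * h v) z v)"
      by (simp add: fun_eq_iff proj_integrand_def algebra_simps)
    with elim show ?case by (simp add: Hankel_def Fock_proj_def distrib_left)
  qed
  have scale: "Hankel m g (\<lambda>v. a * f v) z = a * Hankel m g f z" for a f z
  proof -
    have "proj_integrand m (\<lambda>v. (g z - g v) * (a * f v)) z = (\<lambda>v. a * proj_integrand m (\<lambda>v. (g z - g v) * f v) z v)"
      by (simp add: fun_eq_iff proj_integrand_def algebra_simps)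
    then show ?thesis by (simp add: Hankel_def Fock_proj_def)
  qed
  show ?thesis
    unfolding Hankel_bounded_def bounded_linear_Fock_Lpm_def Hankel_domain_def
    using AE main add scale by (auto intro!: exI[of _ "Q powr (1 / p)"])
qed

theorem theorem2p12:
  fixes m :: nat and p r :: real and g :: "complex \<Rightarrow> complex"
  assumes "1 \<le> p" and "0 < r"
    and "g \<in> BMO p r" and "g \<in> Omega m"
  shows "Hankel_bounded p m g \<and> Hankel_bounded p m (\<lambda>z. cnj (g z))"
proof -
  have g [measurable]: "g \<in> borel_measurable lebesgue" using assms by (simp add: BMO_def Lp_loc_def)
  have [measurable]: "cnj \<in> borel_measurable borel" by (intro borel_measurable_continuous_onI continuous_intros)
  obtain N where N: "0 \<le> N"
    "\<And>z. (\<integral>\<^sup>+v\<in>cball z r. ennreal (cmod (g v - disc_mean r g z) powr p) \<partial>lebesgue) \<le> ennreal N"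
    using BMO_disc_oscillation[OF assms(1-3)] by blast
  have "cmod (cnj (g v) - cnj (disc_mean r g z)) = cmod (g v - disc_mean r g z)" for v z
    by (simp flip: complex_cnj_diff)
  with N(2) have "(\<integral>\<^sup>+v\<in>cball z r. ennreal (cmod (cnj (g v) - cnj (disc_mean r g z)) powr p) \<partial>lebesgue) \<le> ennreal N" for z
    by simp
  then have "Hankel_bounded p m (\<lambda>z. cnj (g z))"
    by (intro Hankel_bounded_of_disc_oscillation[OF _ assms(1,2) N(1)]) auto
  moreover have "Hankel_bounded p m g"
    by (rule Hankel_bounded_of_disc_oscillation[OF g assms(1,2) N])
  ultimately show ?thesis by simp
qed

end
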